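(* Let $\Gamma$ be a countable group, let $P\subset\mathbb{R}$ be a closed subset such that the action of $\mathbb{R}$ on the hull $\Omega_P$ is free and uniquely ergodic, and let $\varphi:\Gamma\to\mathbb{R}$ be a quasimorphism with $\varphi(e)=0$ which is not at bounded distance from a homomorphism $\Gamma\to\mathbb{R}$. Let $p$ be a symmetric probability measure on $\Gamma\times\mathbb{R}$, absolutely continuous with respect to Haar measure, whose support generates $\Gamma\times\mathbb{R}$ as a semigroup, and such that $\varphi$ is $p$-integrable. Then there exists a quasimorphism $\varphi':\Gamma\to\mathbb{R}$ at bounded distance from $\varphi$ such that $\Omega_{P(\varphi')}$ admits uncountably many ergodic $p$-stationary Borel probability measures.
   Context: All quasimorphisms are assumed normalized, i.e. vanishing at $e$. $\varphi:\Gamma\to\mathbb{R}$ is a quasimorphism if $\sup_{g,h}|\varphi(gh)-\varphi(g)-\varphi(h)|<\infty$. Functions are at bounded distance if their difference is bounded. $\Gamma$ is discrete. The twist of a closed $P\subset\mathbb{R}$ by $\varphi$ is $P(\varphi):=\{(\gamma,t)\in\Gamma\times\mathbb{R}\mid\varphi(\gamma)+t\in P\}$. For a locally compact second countable group $G$, $\mathscr{C}(G)$ is the space of closed subsets of $G$ with the Chabauty-Fell topology and action $g.Q:=Qg^{-1}$. The hull $\Omega_Q$ of a closed $Q\subset G$ is the closure of its $G$-orbit in $\mathscr{C}(G)$; thus $\Omega_P\subset\mathscr{C}(\mathbb{R})$ and $\Omega_{P(\varphi')}\subset\mathscr{C}(\Gamma\times\mathbb{R})$. Uniquely ergodic means having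 exactly one invariant Borel probability measure. $\varphi$ is $p$-integrable if $\sum_\gamma p_\Gamma(\gamma)|\varphi(\gamma)|<\infty$, where $p_\Gamma$ is the push-forward of $p$ to $\Gamma$. A Borel probability measure $\nu$ is $p$-stationary if $p*\nu=\nu$; ergodic means $(\Gamma\times\mathbb{R})$-ergodic. *)

theory Defs
  imports "HOL-Probability.Probability"
begin

text \<open>
  Groups are written additively but are not assumed commutative (class \<open>group_add\<close>). A countable
  discrete group is a type of sort \<open>{group_add, countable, discrete_topology}\<close>; the product with
  \<open>real\<close> carries the componentwise group structure and the product topology.
\<close>

section \<open>Quasimorphisms and twists\<close>

definition quasimorphism :: "('g::group_add \<Rightarrow> real) \<Rightarrow> bool" where
  "quasimorphism \<phi> \<longleftrightarrow>
     \<phi> 0 = 0 \<and> bdd_above (range (\<lambda>(g, h). \<bar>\<phi> (g + h) - \<phi> g - \<phi> h\<bar>))"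

definition real_homomorphism :: "('g::group_add \<Rightarrow> real) \<Rightarrow> bool" where
  "real_homomorphism \<psi> \<longleftrightarrow> (\<forall>g h. \<psi> (g + h) = \<psi> g + \<psi> h)"

definition bounded_distance :: "('g \<Rightarrow> real) \<Rightarrow> ('g \<Rightarrow> real) \<Rightarrow> bool" where
  "bounded_distance \<phi> \<psi> \<longleftrightarrow> bounded (range (\<lambda>g. \<phi> g - \<psi> g))"

definition twist :: "real set \<Rightarrow> ('g \<Rightarrow> real) \<Rightarrow> ('g \<times> real) set" where
  "twist P \<phi> = {(\<gamma>, t). \<phi> \<gamma> + t \<in> P}"

section \<open>The Chabauty-Fell space and hulls\<close>

text \<open>The set of closed sets \<open>\<C>(G)\<close> is the carrier of the topology; see \<open>topspace_chabauty_fell\<close>.\<close>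

definition chabauty_fell :: "'a::topological_space set topology" where
  "chabauty_fell = topology_generated_by
     ({{C. closed C \<and> C \<inter> K = {}} | K. compact K} \<union> {{C. closed C \<and> C \<inter> U \<noteq> {}} | U. open U})"

lemma topspace_chabauty_fell:
  "topspace (chabauty_fell :: 'a::topological_space set topology) = {C. closed C}"
proof -
  have "{C::'a set. closed C} = {C. closed C \<and> C \<inter> {} = {}}" by simp
  then show ?thesis
    unfolding chabauty_fell_def topology_generated_by_topspace
    by (intro equalityI) (blast, use compact_empty in blast)
qed

text \<open>The action \<open>g.Q = Q g\<^sup>-\<^sup>1\<close>.\<close>

definition translate :: "'a::group_add \<Rightarrow> 'a set \<Rightarrow> 'a set" where
  "translate g Q = (\<lambda>q. q + - g) ` Q"

definition orbit_closure :: "'a::{topological_space, group_add} set \<Rightarrow> 'a set set" where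
  "orbit_closure Q = chabauty_fell closure_of (range (\<lambda>g. translate g Q))"

definition free_action_on :: "'a::group_add set set \<Rightarrow> bool" where
  "free_action_on \<Omega> \<longleftrightarrow> (\<forall>C\<in>\<Omega>. \<forall>g. translate g C = C \<longrightarrow> g = 0)"

section \<open>Invariant and stationary measures on a hull\<close>

definition borel_algebra_on :: "'a::topological_space set set \<Rightarrow> 'a set measure" where
  "borel_algebra_on \<Omega> = sigma \<Omega> {U. openin (subtopology chabauty_fell \<Omega>) U}"

definition borel_prob_on :: "'a::topological_space set set \<Rightarrow> 'a set measure \<Rightarrow> bool" where
  "borel_prob_on \<Omega> \<nu> \<longleftrightarrow> prob_space \<nu> \<and> sets \<nu> = sets (borel_algebra_on \<Omega>)"

definition invariant_measure :: "'a::group_add set measure \<Rightarrow> bool" where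
  "invariant_measure \<nu> \<longleftrightarrow> (\<forall>g. distr \<nu> \<nu> (translate g) = \<nu>)"

definition uniquely_ergodic_on :: "'a::{topological_space, group_add} set set \<Rightarrow> bool" where
  "uniquely_ergodic_on \<Omega> \<longleftrightarrow> (\<exists>!\<nu>. borel_prob_on \<Omega> \<nu> \<and> invariant_measure \<nu>)"

text \<open>The convolution \<open>p * \<nu>\<close> is the push-forward of \<open>p \<times> \<nu>\<close> under the action map.\<close>

definition stationary_measure :: "'a::group_add measure \<Rightarrow> 'a set measure \<Rightarrow> bool" where
  "stationary_measure p \<nu> \<longleftrightarrow> distr (p \<Otimes>\<^sub>M \<nu>) \<nu> (\<lambda>(g, C). translate g C) = \<nu>"

definition ergodic_measure :: "'a::group_add set measure \<Rightarrow> bool" where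
  "ergodic_measure \<nu> \<longleftrightarrow>
     (\<forall>A\<in>sets \<nu>. (\<forall>g. translate g ` A = A) \<longrightarrow> emeasure \<nu> A = 0 \<or> emeasure \<nu> A = 1)"

section \<open>Measures on \<open>\<Gamma> \<times> \<real>\<close>\<close>

text \<open>A Haar measure on \<open>\<Gamma> \<times> \<real>\<close> for countable discrete \<open>\<Gamma>\<close>: counting measure times Lebesgue measure.
  By \<open>sets_haar_prod\<close> it is a Borel measure, and by \<open>distr_haar_prod\<close> it is left-invariant.\<close>

definition haar_prod :: "('g \<times> real) measure" where
  "haar_prod = count_space UNIV \<Otimes>\<^sub>M lborel"

lemma sets_haar_prod:
  "sets (haar_prod :: ('g::{countable, discrete_topology} \<times> real) measure) = sets borel"
proof
  let ?M = "count_space UNIV \<Otimes>\<^sub>M lborel :: ('g \<times> real) measure"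
  have "(A \<times> B :: ('g \<times> real) set) \<in> sets borel" if "B \<in> sets borel" for A B
  proof -
    have "A \<in> sets borel" by (rule borel_open[OF discrete_topology_class.open_discrete])
    then show ?thesis using that by (rule borel_Times)
  qed
  then have "sigma_sets (space borel)
      {A \<times> B |A B. A \<in> sets (count_space (UNIV :: 'g set)) \<and> B \<in> sets (lborel :: real measure)}
      \<subseteq> sets borel"
    by (intro sets.sigma_sets_subset) auto
  then show "sets (haar_prod :: ('g \<times> real) measure) \<subseteq> sets borel"
    by (simp add: haar_prod_def sets_pair_measure)
  have "U \<in> sets ?M" if U: "open U" for U :: "('g \<times> real) set"
  proof -
    have "open (Pair \<gamma> -` U)" for \<gamma>
      by (intro open_vimage U continuous_intros)
    then have "(\<Union>\<gamma>. {\<gamma>} \<times> (Pair \<gamma> -` U)) \<in> sets ?M"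
      by (intro sets.countable_UN') (auto intro!: pair_measureI)
    also have "(\<Union>\<gamma>. {\<gamma>} \<times> (Pair \<gamma> -` U)) = U" by auto
    finally show ?thesis .
  qed
  then show "sets (borel :: ('g \<times> real) measure) \<subseteq> sets haar_prod"
    using sets.sigma_sets_subset[of "{U. open U}" ?M]
    by (auto simp: haar_prod_def borel_def space_pair_measure)
qed

lemma distr_haar_prod:
  fixes g :: "'g::{group_add, countable, discrete_topology} \<times> real"
  shows "distr haar_prod haar_prod (\<lambda>x. g + x) = haar_prod"
proof -
  obtain a s where g: "g = (a, s)" by fastforce
  have cs: "distr (count_space UNIV) (count_space UNIV) (\<lambda>\<gamma>::'g. a + \<gamma>) = count_space UNIV"
    by (intro distr_bij_count_space bij_betw_byWitness[where f' = "\<lambda>\<gamma>. - a + \<gamma>"])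
       (auto simp flip: add.assoc)
  have lb: "distr lborel lborel (\<lambda>t. s + t) = lborel"
    by (subst lborel_distr_plus[of s, symmetric], rule distr_cong) auto
  interpret c: sigma_finite_measure "count_space (UNIV :: 'g set)"
    by (simp add: sigma_finite_measure_count_space)
  have "distr (count_space UNIV) (count_space UNIV) (\<lambda>\<gamma>. a + \<gamma>) \<Otimes>\<^sub>M distr lborel lborel (\<lambda>t. s + t)
      = distr (count_space UNIV \<Otimes>\<^sub>M lborel) (count_space UNIV \<Otimes>\<^sub>M lborel) (\<lambda>(\<gamma>, t). (a + \<gamma>, s + t))"
    by (intro pair_measure_distr) (auto simp: lb intro: lborel.sigma_finite_measure_axioms)
  then show ?thesis unfolding cs lb haar_prod_def g by (simp add: case_prod_unfold plus_prod_def)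
qed

definition measure_support :: "'a::topological_space measure \<Rightarrow> 'a set" where
  "measure_support p = {x. \<forall>U. open U \<and> x \<in> U \<longrightarrow> emeasure p U > 0}"

definition semigroup_generated :: "'a::group_add set \<Rightarrow> 'a set" where
  "semigroup_generated S = (\<lambda>T. \<forall>x\<in>T. \<forall>y\<in>T. x + y \<in> T) hull S"

definition symmetric_measure :: "'a::group_add measure \<Rightarrow> bool" where
  "symmetric_measure p \<longleftrightarrow> distr p p uminus = p"

definition p_integrable :: "('g \<times> real) measure \<Rightarrow> ('g \<Rightarrow> real) \<Rightarrow> bool" where
  "p_integrable p \<phi> \<longleftrightarrow>
     (\<lambda>\<gamma>. measure (distr p (count_space UNIV) fst) {\<gamma>} * \<bar>\<phi> \<gamma>\<bar>) summable_on UNIV"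

end

theory Submission
  imports Defs
begin

text \<open>
  The quasimorphism \<open>\<phi>\<close> is replaced by a rounded version \<open>\<phi>'\<close>: on the window \<open>m\<^sup>2 \<le> \<phi> < (m + 1)\<^sup>2\<close>, the value
  of \<open>\<phi>\<close> is rounded down to a multiple of \<open>c m\<close>, where the sequence \<open>c\<close> in \<open>[1, 2]\<close> comes close to
  every point of \<open>[1, 2]\<close> infinitely often. Since \<open>\<phi>\<close> is unbounded, its values are coarsely dense in a
  half-line, so the translates \<open>x \<mapsto> \<phi>' (x + g) - \<phi>' g\<close> see arbitrarily long windows with \<open>c m\<close> close to any
  prescribed \<open>c \<in> [1, 2]\<close>. Compactness yields limits of translates whose values lie in \<open>c\<int>\<close>; divided
  by \<open>c\<close>, they form a nonempty compact invariant set \<open>K\<close> of integer-valued functions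
  (\<open>integral_limits_nonempty\<close>).

  On \<open>K\<close> there is an ergodic stationary probability measure \<open>\<mu>\<close> for the projection of \<open>p\<close> to the group
  (\<open>ergodic_stationary_measure_exists\<close>). It is found among finitely additive measures on the countable
  algebra of sets determined by finitely many coordinates: these form a compact set, Cesaro averages
  show that some are stationary, and one maximising a strictly convex functional is extreme. It is
  countably additive by compactness of \<open>K\<close>, and ergodic by extremality.

  Let \<open>m\<close> be the invariant probability measure on the hull of \<open>P\<close>; being unique, it is ergodic. The map
  \<open>(k, Q) \<mapsto> twist Q (c k)\<close> sends \<open>K\<close> times the hull of \<open>P\<close> to the hull of the twist \<open>P(\<phi>')\<close>, and the
  action of \<open>(g, s)\<close> becomes a skew product: \<open>g\<close> acts on \<open>k\<close>, and \<open>Q\<close> is translated by \<open>s + c k(g)\<close>.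
  Since \<open>m\<close> is translation invariant and ergodic, the image of \<open>\<mu> \<times> m\<close> is stationary and ergodic
  (\<open>ergodic_stationary_on_twist_hull\<close>).

  Distinct parameters are told apart at one group element \<open>\<gamma>\<close> where \<open>\<phi>\<close> is large. For almost every set
  with respect to the measure for \<open>c\<close>, the fibre over \<open>\<gamma>\<close> is the fibre over \<open>0\<close> moved by an element of
  \<open>c\<int>\<close>, and by freeness this element is unique and nonzero. So equal measures have commensurable
  parameters, and commensurability classes are countable.
\<close>

section \<open>Existence of ergodic stationary measures\<close>

lemma compact_product_box:
  fixes B :: "'a \<Rightarrow> 'b::topological_space set"
  assumes "\<And>x. compact (B x)"
  shows "compact {f. \<forall>x. f x \<in> B x}"
proof -
  have "compactin (product_topology (\<lambda>_::'a. euclidean) UNIV) (PiE UNIV B)"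
    by (subst compactin_PiE) (use assms in auto)
  then have "compact (PiE UNIV B)"
    by (simp add: euclidean_product_topology flip: compactin_euclidean_iff)
  also have "PiE UNIV B = {f. \<forall>x. f x \<in> B x}" by auto
  finally show ?thesis .
qed

text \<open>
  A countable family of maps \<open>a g\<close> on a space \<open>K\<close>, seen through an algebra \<open>M\<close> of subsets that plays the
  part of the clopen sets of a compact totally disconnected space: \<open>M\<close> is preserved by preimages, and a
  decreasing sequence in \<open>M\<close> with empty intersection reaches the empty set. A countable
  intersection-stable family \<open>C\<close> generates the same sigma-algebra. No group law is needed; \<open>q\<close> is the law of
  the index of the random map applied in one step.
\<close>

locale finitary_action =
  fixes K :: "'k set" and M :: "'k set set" and C :: "nat \<Rightarrow> 'k set"
    and q :: "'g::countable measure" and a :: "'g \<Rightarrow> 'k \<Rightarrow> 'k"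
  assumes algebra_M: "algebra K M"
    and nonempty: "K \<noteq> {}"
    and compact_M: "\<And>A. range A \<subseteq> M \<Longrightarrow> decseq A \<Longrightarrow> (\<Inter>i. A i) = {} \<Longrightarrow> \<exists>i. A i = {}"
    and C_in_M: "range C \<subseteq> M"
    and C_stable: "Int_stable (range C)"
    and C_whole: "K \<in> range C"
    and C_generates: "sigma_sets K M = sigma_sets K (range C)"
    and act_closed: "\<And>g k. k \<in> K \<Longrightarrow> a g k \<in> K"
    and act_M: "\<And>g A. A \<in> M \<Longrightarrow> a g -` A \<inter> K \<in> M"
    and prob_q: "prob_space q"
    and sets_q: "sets q = UNIV"
begin

lemma space_q: "space q = UNIV"
  using sets_q sets.sets_into_space[of UNIV q] by auto

lemma measurable_q: "f \<in> borel_measurable q"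
  by (simp add: measurable_def sets_q space_q)

lemma integrable_q:
  fixes f :: "'g \<Rightarrow> real"
  assumes "\<And>g. f g \<in> {0..1}"
  shows "integrable q f"
proof -
  interpret prob_space q by (rule prob_q)
  show ?thesis
    by (rule integrable_const_bound[where B = 1]) (use assms in \<open>auto simp: measurable_q\<close>)
qed

text \<open>
  Finitely additive probability measures on \<open>M\<close>. Values outside \<open>M\<close> are arbitrary in \<open>[0, 1]\<close>, so that
  the charges form a closed subset of a product of unit intervals.
\<close>

definition charges :: "('k set \<Rightarrow> real) set" where
  "charges = {f. (\<forall>A. f A \<in> {0..1}) \<and> f K = 1 \<and>
     (\<forall>A\<in>M. \<forall>B\<in>M. A \<inter> B = {} \<longrightarrow> f (A \<union> B) = f A + f B)}"

text \<open>The convolution of \<open>q\<close> with a charge.\<close>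

definition avg :: "('k set \<Rightarrow> real) \<Rightarrow> 'k set \<Rightarrow> real" where
  "avg f A = (\<integral>g. f (a g -` A \<inter> K) \<partial>q)"

text \<open>Charges that convolution with \<open>q\<close> moves by at most \<open>e\<close> on each set of \<open>M\<close>; for \<open>e = 0\<close> these are
  the stationary charges.\<close>

definition almost_stationary :: "real \<Rightarrow> ('k set \<Rightarrow> real) set" where
  "almost_stationary e = {f \<in> charges. \<forall>A\<in>M. \<bar>avg f A - f A\<bar> \<le> e}"

lemma closed_charges: "closed charges"
proof -
  have "charges = (\<Inter>A. {f. 0 \<le> f A}) \<inter> (\<Inter>A. {f. f A \<le> 1}) \<inter> {f. f K = 1} \<inter>
      (\<Inter>A\<in>M. \<Inter>B\<in>M. {f. A \<inter> B = {} \<longrightarrow> f (A \<union> B) = f A + f B})"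
    by (auto simp: charges_def)
  also have "closed \<dots>"
    by (intro closed_Int closed_INT ballI closed_Collect_imp closed_Collect_le closed_Collect_eq
        continuous_intros continuous_on_product_coordinates open_Collect_const)
  finally show ?thesis .
qed

lemma compact_charges: "compact charges"
proof -
  have "{f. \<forall>x. f x \<in> {0..1}} \<inter> charges = charges"
    by (auto simp: charges_def)
  moreover have "compact ({f. \<forall>x. f x \<in> {0..1}} \<inter> charges)"
    by (intro compact_Int_closed closed_charges compact_product_box compact_Icc)
  ultimately show ?thesis by simp
qed

text \<open>Truncating the average to finitely many group elements gives a continuous function, uniformly
  close to the full average.\<close>

lemma continuous_on_avg: "continuous_on charges (\<lambda>f. avg f A)"
proof -
  interpret prob_space q by (rule prob_q)
  define F where "F n = {g::'g. to_nat g < n}" for n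
  have finF: "finite (F n)" for n
    by (rule inj_on_finite[of to_nat _ "{..<n}"]) (auto simp: F_def inj_on_def)
  have setsF[measurable]: "S \<in> sets q" for S
    by (simp add: sets_q)
  let ?B = "\<lambda>g. a g -` A \<inter> K"
  have trunc: "(\<integral>g. indicator (F n) g * f (?B g) \<partial>q) = (\<Sum>g\<in>F n. f (?B g) * measure q {g})" for f n
  proof -
    have "(\<integral>g. indicator (F n) g * f (?B g) \<partial>q)
        = (\<integral>g. (\<Sum>h\<in>F n. f (?B h) * indicator {h} g) \<partial>q)"
    proof (intro Bochner_Integration.integral_cong refl)
      fix g
      have "(\<Sum>h\<in>F n. f (?B h) * indicator {h} g) = (\<Sum>h\<in>F n. if h = g then f (?B h) else 0)"
        by (intro sum.cong) (auto simp: indicator_def)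
      then show "indicator (F n) g * f (?B g) = (\<Sum>h\<in>F n. f (?B h) * indicator {h} g)"
        by (simp add: finF indicator_def)
    qed
    also have "\<dots> = (\<Sum>h\<in>F n. \<integral>g. f (?B h) * indicator {h} g \<partial>q)"
      by (intro Bochner_Integration.integral_sum) (auto simp: emeasure_eq_measure)
    finally show ?thesis by simp
  qed
  have "uniform_limit charges (\<lambda>n f. \<Sum>g\<in>F n. f (?B g) * measure q {g}) (\<lambda>f. avg f A) sequentially"
  proof (rule uniform_limitI)
    fix e :: real assume e: "0 < e"
    have "(\<lambda>n. measure q (F n)) \<longlonglongrightarrow> measure q (\<Union>n. F n)"
      by (rule finite_Lim_measure_incseq) (auto simp: F_def incseq_def)
    moreover have "(\<Union>n. F n) = UNIV" by (auto simp: F_def)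
    ultimately have "(\<lambda>n. measure q (F n)) \<longlonglongrightarrow> 1"
      using prob_space space_q by simp
    then have "eventually (\<lambda>n. measure q (F n) > 1 - e) sequentially"
      using e by (intro order_tendstoD) auto
    then show "\<forall>\<^sub>F n in sequentially. \<forall>f\<in>charges.
        dist (\<Sum>g\<in>F n. f (?B g) * measure q {g}) (avg f A) < e"
    proof eventually_elim
      case (elim n)
      show ?case
      proof
        fix f assume "f \<in> charges"
        then have f: "f A \<in> {0..1}" for A by (auto simp: charges_def)
        have f01: "0 \<le> f A" "f A \<le> 1" for A using f[of A] by auto
        have i1: "integrable q (\<lambda>g. f (?B g))" by (intro integrable_q f)
        have i2: "integrable q (\<lambda>g. indicator (F n) g * f (?B g))"
          by (intro integrable_q) (use f01 in \<open>auto simp: indicator_def\<close>)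
        have "avg f A - (\<Sum>g\<in>F n. f (?B g) * measure q {g})
            = (\<integral>g. f (?B g) - indicator (F n) g * f (?B g) \<partial>q)"
          unfolding avg_def trunc[symmetric] using i1 i2 by simp
        also have "\<dots> = (\<integral>g. indicator (- F n) g * f (?B g) \<partial>q)"
          by (intro Bochner_Integration.integral_cong) (auto simp: indicator_def)
        finally have eq: "avg f A - (\<Sum>g\<in>F n. f (?B g) * measure q {g})
            = (\<integral>g. indicator (- F n) g * f (?B g) \<partial>q)" .
        have "(\<integral>g. indicator (- F n) g * f (?B g) \<partial>q) \<le> (\<integral>g. indicator (- F n) g \<partial>q)"
          by (intro integral_mono integrable_q) (use f01 in \<open>auto simp: indicator_def\<close>)
        also have "\<dots> = 1 - measure q (F n)"
          using prob_compl[of "F n"] by (simp add: space_q Compl_eq_Diff_UNIV)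
        also have "\<dots> < e" using elim by simp
        finally have "(\<integral>g. indicator (- F n) g * f (?B g) \<partial>q) < e" .
        moreover have "0 \<le> (\<integral>g. indicator (- F n) g * f (?B g) \<partial>q)"
          by (intro Bochner_Integration.integral_nonneg) (use f01 in auto)
        ultimately show "dist (\<Sum>g\<in>F n. f (?B g) * measure q {g}) (avg f A) < e"
          using eq by (simp add: dist_real_def)
      qed
    qed
  qed
  then show ?thesis
    by (rule uniform_limit_theorem[rotated])
       (auto intro!: always_eventually continuous_intros
         continuous_on_subset[OF continuous_on_product_coordinates])
qed

lemma closed_almost_stationary: "closed (almost_stationary e)"
proof -
  have "M \<noteq> {}" using C_in_M by auto
  then have "almost_stationary e = (\<Inter>A\<in>M. charges \<inter> (\<lambda>f. \<bar>avg f A - f A\<bar>) -` {..e})"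
    by (auto simp: almost_stationary_def)
  also have "closed \<dots>"
    by (intro closed_INT ballI continuous_closed_preimage closed_charges continuous_intros
        continuous_on_avg continuous_on_subset[OF continuous_on_product_coordinates]) auto
  finally show ?thesis .
qed

lemma avg_in_charges:
  assumes "f \<in> charges"
  shows "avg f \<in> charges"
proof -
  interpret prob_space q by (rule prob_q)
  have f: "f A \<in> {0..1}" for A using assms by (auto simp: charges_def)
  have f01: "0 \<le> f A" "f A \<le> 1" for A using f[of A] by auto
  have int: "integrable q (\<lambda>g. f (a g -` A \<inter> K))" for A by (intro integrable_q f)
  have "avg f A \<le> (\<integral>g. 1 \<partial>q)" for A
    unfolding avg_def by (intro integral_mono int) (use f01 in auto)
  then have 1: "avg f A \<in> {0..1}" for A
    using f01 by (auto simp: prob_space avg_def intro!: Bochner_Integration.integral_nonneg)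
  have "a g -` K \<inter> K = K" for g using act_closed by auto
  then have 2: "avg f K = 1"
    using assms prob_space by (simp add: avg_def charges_def)
  have 3: "avg f (A \<union> B) = avg f A + avg f B" if AB: "A \<in> M" "B \<in> M" "A \<inter> B = {}" for A B
  proof -
    have "f (a g -` (A \<union> B) \<inter> K) = f (a g -` A \<inter> K) + f (a g -` B \<inter> K)" for g
    proof -
      have "a g -` (A \<union> B) \<inter> K = (a g -` A \<inter> K) \<union> (a g -` B \<inter> K)" by auto
      moreover have "(a g -` A \<inter> K) \<inter> (a g -` B \<inter> K) = {}" using AB(3) by auto
      ultimately show ?thesis
        using assms act_M[OF AB(1), of g] act_M[OF AB(2), of g] by (simp add: charges_def)
    qed
    then show ?thesis unfolding avg_def using int by simp
  qed
  show ?thesis using 1 2 3 by (auto simp: charges_def)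
qed

lemma almost_stationary_nonempty:
  assumes "0 < e"
  shows "almost_stationary e \<noteq> {}"
proof -
  interpret prob_space q by (rule prob_q)
  obtain k0 where k0: "k0 \<in> K" using nonempty by auto
  define \<delta> where "\<delta> A = (if k0 \<in> A then 1 else 0::real)" for A
  have "\<delta> \<in> charges"
    using k0 by (auto simp: charges_def \<delta>_def)
  then have u: "(avg ^^ n) \<delta> \<in> charges" for n
    by (induction n) (auto intro: avg_in_charges)
  then have u01: "0 \<le> (avg ^^ n) \<delta> A" "(avg ^^ n) \<delta> A \<le> 1" for n A
    by (auto simp: charges_def)
  obtain N :: nat where N: "1 / e < real N" using reals_Archimedean2 by blast
  then have N0: "0 < real N" using assms by (meson divide_pos_pos less_trans zero_less_one)
  \<comment> \<open>a Cesaro average of the orbit of a point mass; convolution changes it by two terms over \<open>N\<close>\<close>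
  define f where "f A = (\<Sum>n<N. (avg ^^ n) \<delta> A) / N" for A
  have "f \<in> charges"
  proof -
    have "(\<Sum>n<N. (avg ^^ n) \<delta> A) \<le> (\<Sum>n<N. 1)" for A by (intro sum_mono u01)
    then have "f A \<in> {0..1}" for A
      using N0 u01 by (auto simp: f_def field_simps intro!: sum_nonneg)
    moreover have "f K = 1" using u N0 by (simp add: f_def charges_def)
    moreover have "f (A \<union> B) = f A + f B" if "A \<in> M" "B \<in> M" "A \<inter> B = {}" for A B
    proof -
      have "(avg ^^ n) \<delta> (A \<union> B) = (avg ^^ n) \<delta> A + (avg ^^ n) \<delta> B" for n
        using u[of n] that by (simp add: charges_def)
      then show ?thesis by (simp add: f_def sum.distrib add_divide_distrib)
    qed
    ultimately show ?thesis by (auto simp: charges_def)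
  qed
  moreover have "\<bar>avg f A - f A\<bar> \<le> e" for A
  proof -
    have "avg f A = (\<Sum>n<N. \<integral>g. (avg ^^ n) \<delta> (a g -` A \<inter> K) \<partial>q) / N"
      unfolding avg_def[of f] f_def
      by (subst Bochner_Integration.integral_sum[symmetric])
         (auto intro!: integrable_q simp: u01)
    also have "\<dots> = (\<Sum>n<N. (avg ^^ Suc n) \<delta> A) / N"
      by (simp add: avg_def)
    finally have "avg f A - f A = ((avg ^^ N) \<delta> A - \<delta> A) / N"
      using sum_lessThan_telescope[of "\<lambda>n. (avg ^^ n) \<delta> A" N]
      by (simp add: f_def sum_subtractf flip: diff_divide_distrib)
    moreover have "\<bar>(avg ^^ N) \<delta> A - \<delta> A\<bar> \<le> 1"
      using u01[of N A] by (auto simp: \<delta>_def)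
    ultimately have "\<bar>avg f A - f A\<bar> \<le> 1 / N"
      using N0 by (simp add: divide_right_mono)
    also have "\<dots> \<le> e" using N N0 assms by (simp add: field_simps)
    finally show ?thesis .
  qed
  ultimately show ?thesis by (auto simp: almost_stationary_def)
qed

lemma stationary_charge_exists: "almost_stationary 0 \<noteq> {}"
proof -
  have "charges \<inter> (\<Inter>n::nat. almost_stationary (1 / Suc n)) \<noteq> {}"
  proof (rule compact_imp_fip_image[OF compact_charges])
    fix I' :: "nat set" assume I': "finite I'"
    show "charges \<inter> (\<Inter>n\<in>I'. almost_stationary (1 / Suc n)) \<noteq> {}"
    proof -
      obtain f where f: "f \<in> almost_stationary (1 / Suc (Max (insert 0 I')))"
        using almost_stationary_nonempty[of "1 / Suc (Max (insert 0 I'))"] by auto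
      have "f \<in> almost_stationary (1 / Suc n)" if "n \<in> I'" for n
      proof -
        have "n \<le> Max (insert 0 I')" using that I' by (intro Max_ge) auto
        then have "1 / real (Suc (Max (insert 0 I'))) \<le> 1 / real (Suc n)"
          by (intro divide_left_mono) auto
        then show ?thesis using f unfolding almost_stationary_def by (blast intro: order_trans)
      qed
      then show ?thesis using f by (auto simp: almost_stationary_def)
    qed
  qed (rule closed_almost_stationary)
  then obtain f where f: "f \<in> charges" "\<And>n::nat. f \<in> almost_stationary (1 / Suc n)" by auto
  have "\<bar>avg f A - f A\<bar> \<le> 0" if "A \<in> M" for A
  proof (rule LIMSEQ_le_const)
    show "(\<lambda>n. 1 / real (Suc n)) \<longlonglongrightarrow> 0" by (rule LIMSEQ_Suc[OF lim_1_over_n])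
    show "\<exists>N. \<forall>n\<ge>N. \<bar>avg f A - f A\<bar> \<le> 1 / real (Suc n)"
      using f(2) that by (auto simp: almost_stationary_def)
  qed
  then show ?thesis using f(1) by (auto simp: almost_stationary_def)
qed

text \<open>A convex functional on charges, given by a weighted sum of squares over the countable family \<open>C\<close>.\<close>

definition energy :: "('k set \<Rightarrow> real) \<Rightarrow> real" where
  "energy f = (\<Sum>n. (1/2)^n * (f (C n))\<^sup>2)"

lemma summable_energy:
  assumes "f \<in> charges"
  shows "summable (\<lambda>n. (1/2)^n * (f (C n))\<^sup>2)"
proof (rule summable_comparison_test'[where g = "\<lambda>n. (1/2)^n" and N = 0])
  fix n
  have "0 \<le> f (C n)" "f (C n) \<le> 1" using assms by (auto simp: charges_def)
  then show "norm ((1/2)^n * (f (C n))\<^sup>2) \<le> (1/2)^n"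
    by (simp add: power_le_one mult_left_le)
qed simp

lemma continuous_on_energy: "continuous_on charges energy"
proof -
  have "uniform_limit charges (\<lambda>n f. \<Sum>i<n. (1/2)^i * (f (C i))\<^sup>2) energy sequentially"
    unfolding energy_def
  proof (rule Weierstrass_m_test)
    fix n and f :: "'k set \<Rightarrow> real" assume "f \<in> charges"
    then have "0 \<le> f (C n)" "f (C n) \<le> 1" by (auto simp: charges_def)
    then show "norm ((1/2)^n * (f (C n))\<^sup>2) \<le> (1/2)^n"
      by (simp add: power_le_one mult_left_le)
  qed simp
  then show ?thesis
    by (rule uniform_limit_theorem[rotated])
       (auto intro!: always_eventually continuous_intros
         continuous_on_subset[OF continuous_on_product_coordinates])
qed

lemma max_energy_charge:
  obtains f where "f \<in> almost_stationary 0" "\<And>h. h \<in> almost_stationary 0 \<Longrightarrow> energy h \<le> energy f"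
proof -
  have sub: "almost_stationary 0 \<subseteq> charges" by (auto simp: almost_stationary_def)
  then have "compact (almost_stationary 0)"
    using compact_Int_closed[OF compact_charges closed_almost_stationary[of 0]] by (simp add: inf.absorb2)
  then obtain f where "f \<in> almost_stationary 0" "\<forall>h\<in>almost_stationary 0. energy h \<le> energy f"
    using continuous_attains_sup[OF _ stationary_charge_exists continuous_on_subset[OF continuous_on_energy sub]]
    by auto
  then show thesis by (intro that) auto
qed

text \<open>The energy is strictly convex in the values on the sets \<open>C n\<close>, and these determine the measure; so
  a maximiser among the stationary charges is an extreme point.\<close>

lemma max_energy_extreme:
  assumes f: "f \<in> almost_stationary 0" "\<And>h. h \<in> almost_stationary 0 \<Longrightarrow> energy h \<le> energy f"
    and f12: "f1 \<in> almost_stationary 0" "f2 \<in> almost_stationary 0"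
    and t: "0 < t" "t < 1" and conv: "\<And>n. f (C n) = t * f1 (C n) + (1 - t) * f2 (C n)"
  shows "f1 (C n) = f2 (C n)"
proof -
  let ?S = "\<lambda>f. \<lambda>n. (1/2)^n * (f (C n))\<^sup>2 :: real"
  let ?d = "\<lambda>n. (1/2)^n * (t * (1 - t) * (f1 (C n) - f2 (C n))\<^sup>2)"
  have ch: "f \<in> charges" "f1 \<in> charges" "f2 \<in> charges"
    using f f12 by (auto simp: almost_stationary_def)
  note sums = ch[THEN summable_energy]
  have eq: "?d n = t * ?S f1 n + (1 - t) * ?S f2 n - ?S f n" for n
    unfolding conv by (simp add: power2_eq_square algebra_simps)
  have ds: "?d sums (t * energy f1 + (1 - t) * energy f2 - energy f)"
    unfolding eq energy_def by (intro sums_diff sums_add sums_mult summable_sums sums)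
  then have sd: "summable ?d" by (rule sums_summable)
  have "suminf ?d = t * energy f1 + (1 - t) * energy f2 - energy f"
    using ds by (rule sums_unique[symmetric])
  also have "\<dots> \<le> t * energy f + (1 - t) * energy f - energy f"
    using f f12 t by (intro diff_right_mono add_mono mult_left_mono) auto
  finally have "suminf ?d \<le> 0" by (simp add: algebra_simps)
  moreover have nn: "0 \<le> ?d n" for n using t by simp
  moreover have "0 \<le> suminf ?d" by (rule suminf_nonneg[OF sd nn])
  ultimately have "suminf ?d = 0" by linarith
  then have "?d n = 0" using suminf_eq_zero_iff[OF sd nn] by blast
  then show ?thesis using t by simp
qed

lemma M_subset: "M \<subseteq> Pow K"
proof -
  interpret algebra K M by (rule algebra_M)
  show ?thesis by (rule space_closed)
qed

text \<open>A charge has no mass escaping to the empty set along decreasing sequences, because such sequences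
  are eventually empty; hence Caratheodory's theorem applies.\<close>

lemma charge_extends:
  assumes f: "f \<in> charges"
  obtains \<nu> where "prob_space \<nu>" "space \<nu> = K" "sets \<nu> = sigma_sets K M"
    "\<And>A. A \<in> M \<Longrightarrow> measure \<nu> A = f A"
proof -
  interpret algebra K M by (rule algebra_M)
  have f01: "0 \<le> f A" "f A \<le> 1" for A using f by (auto simp: charges_def)
  have f_add: "f (A \<union> B) = f A + f B" if "A \<in> M" "B \<in> M" "A \<inter> B = {}" for A B
    using f that by (auto simp: charges_def)
  have f_empty: "f {} = 0" using f_add[of "{}" "{}"] by simp
  have "\<exists>\<mu>. (\<forall>A\<in>M. \<mu> A = ennreal (f A)) \<and> measure_space K (sigma_sets K M) \<mu>"
  proof (rule caratheodory_empty_continuous)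
    show "positive M (\<lambda>A. ennreal (f A))" by (simp add: positive_def f_empty)
    show "additive M (\<lambda>A. ennreal (f A))"
      by (auto simp: additive_def f_add f01 ennreal_plus)
    fix A :: "nat \<Rightarrow> 'k set" assume A: "range A \<subseteq> M" "decseq A" "(\<Inter>i. A i) = {}"
    then obtain i where "A i = {}" using compact_M by blast
    then have "eventually (\<lambda>n. ennreal (f (A n)) = 0) sequentially"
      using A(2) f_empty unfolding decseq_def eventually_sequentially
      by (intro exI[of _ i]) (metis ennreal_0 subset_empty)
    then show "(\<lambda>n. ennreal (f (A n))) \<longlonglongrightarrow> 0" by (rule tendsto_eventually)
  qed simp
  then obtain \<mu> where \<mu>: "\<And>A. A \<in> M \<Longrightarrow> \<mu> A = ennreal (f A)" "measure_space K (sigma_sets K M) \<mu>"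
    by blast
  define \<nu> where "\<nu> = measure_of K M \<mu>"
  have sp: "space \<nu> = K" and se: "sets \<nu> = sigma_sets K M"
    unfolding \<nu>_def using M_subset by (simp_all add: space_measure_of sets_measure_of)
  have em: "emeasure \<nu> A = ennreal (f A)" if "A \<in> M" for A
    using emeasure_measure_of[OF \<nu>_def M_subset, of A] \<mu> that
    by (simp add: se measure_space_def sigma_sets.Basic)
  show thesis
  proof (rule that)
    show "prob_space \<nu>"
      by (intro prob_spaceI) (use f em[OF top] in \<open>simp add: sp charges_def\<close>)
    show "measure \<nu> A = f A" if "A \<in> M" for A
      using em[OF that] f01 by (simp add: measure_def)
  qed (fact sp se)+
qed

lemma act_measurable:
  assumes \<nu>: "space \<nu> = K" "sets \<nu> = sigma_sets K M"
  shows "(\<lambda>(g, k). a g k) \<in> measurable (q \<Otimes>\<^sub>M \<nu>) \<nu>"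
proof -
  have "a g \<in> measurable \<nu> \<nu>" for g
  proof (rule measurable_sigma_sets[OF \<nu>(2) M_subset])
    show "a g \<in> space \<nu> \<rightarrow> K" using \<nu>(1) act_closed by auto
    show "a g -` A \<inter> space \<nu> \<in> sets \<nu>" if "A \<in> M" for A
      using act_M[OF that] by (simp add: \<nu>)
  qed
  then have "(\<lambda>(g, k). a g k) \<in> measurable (count_space UNIV \<Otimes>\<^sub>M \<nu>) \<nu>"
    by (intro measurable_pair_measure_countable1) auto
  moreover have "sets (count_space UNIV \<Otimes>\<^sub>M \<nu>) = sets (q \<Otimes>\<^sub>M \<nu>)"
    by (intro sets_pair_measure_cong) (simp_all add: sets_q)
  ultimately show ?thesis by (simp cong: measurable_cong_sets)
qed

lemma emeasure_distr_act:
  assumes \<nu>: "prob_space \<nu>" "space \<nu> = K" "sets \<nu> = sigma_sets K M" and A: "A \<in> sets \<nu>"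
  shows "emeasure (distr (q \<Otimes>\<^sub>M \<nu>) \<nu> (\<lambda>(g, k). a g k)) A
    = ennreal (\<integral>g. measure \<nu> (a g -` A \<inter> K) \<partial>q)"
proof -
  interpret prob_space \<nu> by (rule \<nu>)
  have m: "(\<lambda>(g, k). a g k) \<in> measurable (q \<Otimes>\<^sub>M \<nu>) \<nu>" by (rule act_measurable[OF \<nu>(2,3)])
  have "emeasure (distr (q \<Otimes>\<^sub>M \<nu>) \<nu> (\<lambda>(g, k). a g k)) A
      = (\<integral>\<^sup>+g. emeasure \<nu> (Pair g -` ((\<lambda>(g, k). a g k) -` A \<inter> space (q \<Otimes>\<^sub>M \<nu>))) \<partial>q)"
    by (subst emeasure_distr[OF m A], subst emeasure_pair_measure_alt)
       (auto intro: measurable_sets[OF m A])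
  also have "\<dots> = (\<integral>\<^sup>+g. ennreal (measure \<nu> (a g -` A \<inter> K)) \<partial>q)"
    by (intro nn_integral_cong)
       (auto simp: emeasure_eq_measure space_pair_measure space_q \<nu> vimage_def Int_def intro!: arg_cong[of _ _ "measure \<nu>"])
  also have "\<dots> = ennreal (\<integral>g. measure \<nu> (a g -` A \<inter> K) \<partial>q)"
    by (intro nn_integral_eq_integral integrable_q) auto
  finally show ?thesis .
qed

lemma generated_measure_eqI:
  assumes "prob_space \<mu>" "prob_space \<nu>" "sets \<mu> = sigma_sets K M" "sets \<nu> = sigma_sets K M"
    and "\<And>n. measure \<mu> (C n) = measure \<nu> (C n)"
  shows "\<mu> = \<nu>"
proof (rule measure_eqI_generator_eq[OF C_stable])
  show "range C \<subseteq> Pow K" using C_in_M M_subset by auto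
  show "sets \<mu> = sigma_sets K (range C)" "sets \<nu> = sigma_sets K (range C)"
    using assms C_generates by auto
  interpret \<mu>: prob_space \<mu> by fact
  interpret \<nu>: prob_space \<nu> by fact
  show "emeasure \<mu> X = emeasure \<nu> X" if "X \<in> range C" for X
    using that assms by (auto simp: \<mu>.emeasure_eq_measure \<nu>.emeasure_eq_measure)
  show "emeasure \<mu> K \<noteq> \<infinity>" by simp
qed (use C_whole in auto)

text \<open>If an invariant set had measure strictly between 0 and 1, conditioning on it and on its complement
  would write the maximiser as a proper convex combination of stationary charges.\<close>

theorem ergodic_stationary_measure_exists:
  obtains \<nu> where "prob_space \<nu>" "space \<nu> = K" "sets \<nu> = sigma_sets K M"
    "distr (q \<Otimes>\<^sub>M \<nu>) \<nu> (\<lambda>(g, k). a g k) = \<nu>"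
    "\<And>B. B \<in> sets \<nu> \<Longrightarrow> (\<And>g. a g -` B \<inter> K = B) \<Longrightarrow> measure \<nu> B = 0 \<or> measure \<nu> B = 1"
proof -
  obtain f where f: "f \<in> almost_stationary 0" "\<And>h. h \<in> almost_stationary 0 \<Longrightarrow> energy h \<le> energy f"
    using max_energy_charge by blast
  then have fc: "f \<in> charges" and f_avg: "\<And>A. A \<in> M \<Longrightarrow> avg f A = f A"
    by (auto simp: almost_stationary_def)
  obtain \<nu> where \<nu>: "prob_space \<nu>" "space \<nu> = K" "sets \<nu> = sigma_sets K M"
    and f_eq: "\<And>A. A \<in> M \<Longrightarrow> measure \<nu> A = f A"
    using charge_extends[OF fc] by blast
  interpret prob_space \<nu> by (rule \<nu>)
  interpret pq: prob_space q by (rule prob_q)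
  interpret pair: pair_prob_space q \<nu> ..
  let ?D = "distr (q \<Otimes>\<^sub>M \<nu>) \<nu> (\<lambda>(g, k). a g k)"
  have C_M: "C n \<in> M" for n using C_in_M by auto
  have M_sets: "A \<in> M \<Longrightarrow> A \<in> sets \<nu>" for A by (simp add: \<nu> sigma_sets.Basic)
  have stat: "?D = \<nu>"
  proof (rule generated_measure_eqI)
    show "prob_space ?D" by (intro pair.prob_space_distr act_measurable \<nu>)
    fix n
    have "emeasure ?D (C n) = ennreal (avg f (C n))"
      unfolding avg_def
      by (simp add: emeasure_distr_act[OF \<nu> M_sets[OF C_M]] f_eq act_M C_M)
    also have "\<dots> = ennreal (measure \<nu> (C n))" by (simp add: f_avg f_eq C_M)
    finally show "measure ?D (C n) = measure \<nu> (C n)"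
      by (simp add: Sigma_Algebra.measure_def[of ?D])
  qed (simp_all add: \<nu>)
  have stat_int: "(\<integral>g. measure \<nu> (a g -` A \<inter> K) \<partial>q) = measure \<nu> A" if "A \<in> sets \<nu>" for A
  proof -
    have "ennreal (\<integral>g. measure \<nu> (a g -` A \<inter> K) \<partial>q) = ennreal (measure \<nu> A)"
      using emeasure_distr_act[OF \<nu> that] stat by (simp add: emeasure_eq_measure)
    then show ?thesis by (subst (asm) ennreal_inj) auto
  qed
  \<comment> \<open>conditioning on an invariant set preserves stationarity\<close>
  have cond: "(\<lambda>A. measure \<nu> (A \<inter> B) / measure \<nu> B) \<in> almost_stationary 0"
    if B: "B \<in> sets \<nu>" "\<And>g. a g -` B \<inter> K = B" "measure \<nu> B \<noteq> 0" for B
  proof -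
    have B_K: "B \<subseteq> K" using sets.sets_into_space[OF B(1)] \<nu> by simp
    have "measure \<nu> (A \<inter> B) \<le> measure \<nu> B" for A by (intro finite_measure_mono B) auto
    then have "measure \<nu> (A \<inter> B) / measure \<nu> B \<in> {0..1}" for A
      using B(3) by (auto simp: divide_le_eq_1 zero_less_measure_iff)
    moreover have "measure \<nu> ((A \<union> A') \<inter> B) / measure \<nu> B
        = measure \<nu> (A \<inter> B) / measure \<nu> B + measure \<nu> (A' \<inter> B) / measure \<nu> B"
      if "A \<in> M" "A' \<in> M" "A \<inter> A' = {}" for A A'
    proof -
      have "measure \<nu> ((A \<inter> B) \<union> (A' \<inter> B)) = measure \<nu> (A \<inter> B) + measure \<nu> (A' \<inter> B)"
        using that B M_sets by (intro finite_measure_Union) auto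
      then show ?thesis by (simp add: Int_Un_distrib2 add_divide_distrib)
    qed
    moreover have "avg (\<lambda>A. measure \<nu> (A \<inter> B) / measure \<nu> B) A = measure \<nu> (A \<inter> B) / measure \<nu> B"
      if "A \<in> M" for A
    proof -
      have "a g -` A \<inter> K \<inter> B = a g -` (A \<inter> B) \<inter> K" for g using B(2)[of g] by auto
      then show ?thesis
        unfolding avg_def using stat_int[of "A \<inter> B"] M_sets[OF that] B(1) by simp
    qed
    ultimately show ?thesis
      using B(3) B_K by (auto simp: almost_stationary_def charges_def Int_absorb1)
  qed
  have erg: "measure \<nu> B = 0 \<or> measure \<nu> B = 1"
    if B: "B \<in> sets \<nu>" "\<And>g. a g -` B \<inter> K = B" for B
  proof (rule ccontr)
    assume "\<not> ?thesis"
    then have t: "0 < measure \<nu> B" "measure \<nu> B < 1"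
      using prob_le_1[of B] by (auto simp: zero_less_measure_iff less_le)
    let ?B' = "K - B"
    have B': "?B' \<in> sets \<nu>" "measure \<nu> ?B' = 1 - measure \<nu> B"
      using B(1) prob_compl[OF B(1)] sets.compl_sets[OF B(1)] \<nu>(2) by auto
    have B'_inv: "a g -` ?B' \<inter> K = ?B'" for g
      using B(2)[of g] act_closed[of _ g] by auto
    let ?f1 = "\<lambda>A. measure \<nu> (A \<inter> B) / measure \<nu> B"
      and ?f2 = "\<lambda>A. measure \<nu> (A \<inter> ?B') / measure \<nu> ?B'"
    have C_K: "C n \<subseteq> K" for n using C_M M_subset by auto
    have f12: "?f1 \<in> almost_stationary 0" "?f2 \<in> almost_stationary 0"
      using cond[OF B] cond[OF B'(1) B'_inv] t B'(2) by auto
    have "f (C n) = measure \<nu> B * ?f1 (C n) + (1 - measure \<nu> B) * ?f2 (C n)" for n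
    proof -
      have "measure \<nu> (C n \<inter> B \<union> C n \<inter> ?B') = measure \<nu> (C n \<inter> B) + measure \<nu> (C n \<inter> ?B')"
        using B(1) B'(1) M_sets[OF C_M] by (intro finite_measure_Union) auto
      moreover have "C n \<inter> B \<union> C n \<inter> ?B' = C n" using C_K by auto
      ultimately show ?thesis using t B'(2) by (simp add: f_eq[OF C_M, symmetric])
    qed
    from max_energy_extreme[OF f f12 t this] have agree: "?f1 (C n) = ?f2 (C n)" for n by simp
    have fin: "emeasure \<nu> B \<noteq> 0" "emeasure \<nu> B \<noteq> \<infinity>" "emeasure \<nu> ?B' \<noteq> 0" "emeasure \<nu> ?B' \<noteq> \<infinity>"
      using t B'(2) by (auto simp: emeasure_eq_measure)
    have "uniform_measure \<nu> B = uniform_measure \<nu> ?B'"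
    proof (rule generated_measure_eqI)
      fix n
      show "measure (uniform_measure \<nu> B) (C n) = measure (uniform_measure \<nu> ?B') (C n)"
        using agree[of n] fin M_sets[OF C_M]
        by (simp add: measure_uniform_measure Int_commute)
    qed (simp_all add: \<nu> prob_space_uniform_measure fin)
    then have "measure (uniform_measure \<nu> B) B = measure (uniform_measure \<nu> ?B') B" by simp
    moreover have "measure (uniform_measure \<nu> B) B = 1"
      using fin B(1) t by (simp add: measure_uniform_measure)
    moreover have "?B' \<inter> B = {}" by auto
    then have "measure (uniform_measure \<nu> ?B') B = 0"
      using fin B(1) by (simp add: measure_uniform_measure del: Diff_Int_distrib2)
    ultimately show False by simp
  qed
  show thesis by (rule that[OF \<nu> stat erg])
qed

end

section \<open>The Chabauty-Fell topology\<close>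

lemma mem_translate: "x \<in> translate g C \<longleftrightarrow> x + g \<in> (C :: 'a::group_add set)"
proof
  assume "x + g \<in> C"
  then show "x \<in> translate g C"
    by (auto simp: translate_def image_iff add.assoc intro!: bexI[of _ "x + g"])
qed (auto simp: translate_def add.assoc)

lemma translate_translate: "translate g (translate h C) = translate (g + h) C"
  by (auto simp: mem_translate add.assoc)

lemma closed_translate:
  fixes C :: "'a::{topological_space, group_add} set"
  assumes "\<And>g::'a. continuous_on UNIV (\<lambda>x. x + g)" and "closed C"
  shows "closed (translate g C)"
proof -
  have "translate g C = (\<lambda>x. x + g) -` C" by (auto simp: mem_translate)
  then show ?thesis using closed_vimage[OF assms(2) assms(1)] by simp
qed

lemma openin_chabauty_fell_miss:
  "compact K \<Longrightarrow> openin chabauty_fell {C. closed C \<and> C \<inter> K = {}}"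
  unfolding chabauty_fell_def by (intro topology_generated_by_Basis) auto

lemma openin_chabauty_fell_hit:
  "open U \<Longrightarrow> openin chabauty_fell {C. closed C \<and> C \<inter> U \<noteq> {}}"
  unfolding chabauty_fell_def by (intro topology_generated_by_Basis) auto

lemma continuous_map_into_chabauty_fell:
  fixes f :: "'b \<Rightarrow> 'a::topological_space set"
  assumes cl: "\<And>x. x \<in> topspace X \<Longrightarrow> closed (f x)"
    and miss: "\<And>K. compact K \<Longrightarrow> openin X {x \<in> topspace X. f x \<inter> K = {}}"
    and hit: "\<And>U. open U \<Longrightarrow> openin X {x \<in> topspace X. f x \<inter> U \<noteq> {}}"
  shows "continuous_map X chabauty_fell f"
  unfolding chabauty_fell_def
proof (rule continuous_on_generated_topo, goal_cases)
  case (1 U)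
  then consider K where "compact K" "U = {C. closed C \<and> C \<inter> K = {}}"
    | V where "open V" "U = {C. closed C \<and> C \<inter> V \<noteq> {}}" by auto
  then show ?case
  proof cases
    case (1 K)
    have "f -` U \<inter> topspace X = {x \<in> topspace X. f x \<inter> K = {}}" using cl 1(2) by auto
    then show ?thesis using miss[OF 1(1)] by simp
  next
    case (2 V)
    have "f -` U \<inter> topspace X = {x \<in> topspace X. f x \<inter> V \<noteq> {}}" using cl 2(2) by auto
    then show ?thesis using hit[OF 2(1)] by simp
  qed
next
  case 2
  show ?case
    using topspace_chabauty_fell[where 'a = 'a] cl
    unfolding chabauty_fell_def topology_generated_by_topspace by auto
qed

lemma continuous_map_translate:
  fixes g :: "'a::{topological_space, group_add}"
  assumes cont: "\<And>g::'a. continuous_on UNIV (\<lambda>x. x + g)"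
  shows "continuous_map chabauty_fell chabauty_fell (translate g)"
proof (rule continuous_map_into_chabauty_fell)
  fix K :: "'a set" assume "compact K"
  then have "compact ((\<lambda>x. x + g) ` K)"
    by (intro compact_continuous_image continuous_on_subset[OF cont]) auto
  moreover have "{C \<in> topspace chabauty_fell. translate g C \<inter> K = {}}
      = {C. closed C \<and> C \<inter> (\<lambda>x. x + g) ` K = {}}"
    by (auto simp: topspace_chabauty_fell mem_translate)
  ultimately show "openin chabauty_fell {C \<in> topspace chabauty_fell. translate g C \<inter> K = {}}"
    using openin_chabauty_fell_miss by simp
next
  fix U :: "'a set" assume "open U"
  then have "open ((\<lambda>x. x + - g) -` U)" by (intro open_vimage cont)
  moreover have "{C \<in> topspace chabauty_fell. translate g C \<inter> U \<noteq> {}}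
      = {C. closed C \<and> C \<inter> (\<lambda>x. x + - g) -` U \<noteq> {}}"
    by (auto simp: topspace_chabauty_fell translate_def)
  ultimately show "openin chabauty_fell {C \<in> topspace chabauty_fell. translate g C \<inter> U \<noteq> {}}"
    using openin_chabauty_fell_hit by simp
qed (simp add: topspace_chabauty_fell closed_translate[OF cont])

lemma continuous_on_add_real: "continuous_on UNIV (\<lambda>x. x + g)" for g :: real
  by (intro continuous_intros)

lemma continuous_on_add_prod: "continuous_on UNIV (\<lambda>x. x + g)"
  for g :: "'g::{group_add, discrete_topology} \<times> real"
  unfolding plus_prod_def
  by (intro continuous_intros continuous_on_compose2[OF Topological_Spaces.continuous_on_discrete continuous_on_fst])
     auto

lemma orbit_closure_closed: "C \<in> orbit_closure Q \<Longrightarrow> closed C"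
  using closure_of_subset_topspace[of chabauty_fell] topspace_chabauty_fell
  unfolding orbit_closure_def by blast

lemma translate_orbit_closure:
  fixes Q :: "'a::{topological_space, group_add} set"
  assumes cont: "\<And>g::'a. continuous_on UNIV (\<lambda>x. x + g)" and "C \<in> orbit_closure Q"
  shows "translate g C \<in> orbit_closure Q"
proof -
  have "translate g C \<in> chabauty_fell closure_of (translate g ` range (\<lambda>h. translate h Q))"
    using continuous_map_image_closure_subset[OF continuous_map_translate[OF cont]] assms(2)
    unfolding orbit_closure_def by blast
  moreover have "translate g ` range (\<lambda>h. translate h Q) \<subseteq> range (\<lambda>h. translate h Q)"
    by (auto simp: translate_translate)
  ultimately show ?thesis
    unfolding orbit_closure_def using closure_of_mono by blast
qed

lemma borel_algebra_on_generators: "{U. openin (subtopology chabauty_fell \<Omega>) U} \<subseteq> Pow \<Omega>"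
  using openin_subset by fastforce

lemma space_borel_algebra_on [simp]: "space (borel_algebra_on \<Omega>) = \<Omega>"
  unfolding borel_algebra_on_def using borel_algebra_on_generators by (intro space_measure_of)

lemma openin_sets_borel_algebra_on:
  assumes "openin chabauty_fell U"
  shows "U \<inter> \<Omega> \<in> sets (borel_algebra_on \<Omega>)"
  unfolding borel_algebra_on_def
  using assms by (auto intro!: openin_subtopology_Int borel_algebra_on_generators)

lemma translate_measurable:
  fixes Q :: "'a::{topological_space, group_add} set"
  assumes cont: "\<And>g::'a. continuous_on UNIV (\<lambda>x. x + g)"
  shows "translate g \<in> measurable (borel_algebra_on (orbit_closure Q)) (borel_algebra_on (orbit_closure Q))"
proof -
  have "translate g \<in> measurable (borel_algebra_on (orbit_closure Q))
      (sigma (orbit_closure Q) {U. openin (subtopology chabauty_fell (orbit_closure Q)) U})"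
  proof (rule measurable_measure_of[OF borel_algebra_on_generators])
    show "translate g \<in> space (borel_algebra_on (orbit_closure Q)) \<rightarrow> orbit_closure Q"
      using translate_orbit_closure[OF cont] by auto
    fix A assume "A \<in> {U. openin (subtopology chabauty_fell (orbit_closure Q)) U}"
    then obtain V where V: "openin chabauty_fell V" "A = V \<inter> orbit_closure Q"
      by (auto simp: openin_subtopology)
    have "translate g -` A \<inter> orbit_closure Q
        = {C \<in> topspace chabauty_fell. translate g C \<in> V} \<inter> orbit_closure Q"
      using translate_orbit_closure[OF cont] orbit_closure_closed
      by (auto simp: V topspace_chabauty_fell)
    also have "\<dots> \<in> sets (borel_algebra_on (orbit_closure Q))"
      by (intro openin_sets_borel_algebra_on openin_continuous_map_preimage[OF continuous_map_translate[OF cont] V(1)])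
    finally show "translate g -` A \<inter> space (borel_algebra_on (orbit_closure Q))
        \<in> sets (borel_algebra_on (orbit_closure Q))" by simp
  qed
  then show ?thesis by (simp add: borel_algebra_on_def)
qed

section \<open>Twists\<close>

text \<open>
  The action on functions modulo constants, normalised at the identity: translate the argument by \<open>g\<close>
  and subtract a constant so that the result vanishes at \<open>0\<close>.
\<close>

definition fiber_act :: "'g::group_add \<Rightarrow> ('g \<Rightarrow> 'b::group_add) \<Rightarrow> 'g \<Rightarrow> 'b" where
  "fiber_act g f = (\<lambda>x. f (x + g) - f g)"

lemma mem_twist: "(x, t) \<in> twist P f \<longleftrightarrow> f x + t \<in> P"
  by (simp add: twist_def)

text \<open>The action on twists is a skew product over \<open>fiber_act\<close> with cocycle \<open>f g\<close>.\<close>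

lemma twist_translate:
  "translate (g, s) (twist P f) = twist (translate (s + f g) P) (fiber_act g f)"
  by (auto simp: mem_translate mem_twist fiber_act_def plus_prod_def algebra_simps)

lemma closed_twist:
  fixes f :: "'g::discrete_topology \<Rightarrow> real"
  assumes "closed P"
  shows "closed (twist P f)"
proof -
  have "twist P f = (\<lambda>x. f (fst x) + snd x) -` P" by (auto simp: twist_def)
  also have "closed \<dots>"
    by (intro closed_vimage assms continuous_intros
        continuous_on_compose2[OF Topological_Spaces.continuous_on_discrete continuous_on_fst]) auto
  finally show ?thesis .
qed

lemma finite_compact_discrete:
  fixes S :: "'a::discrete_topology set"
  assumes "compact S"
  shows "finite S"
proof -
  obtain D where "D \<subseteq> S" "finite D" "S \<subseteq> (\<Union>x\<in>D. {x})"
    by (rule compactE_image[OF assms, of S "\<lambda>x. {x}"]) (auto simp: discrete_topology_class.open_discrete)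
  then show ?thesis by (auto intro: finite_subset)
qed

lemma continuous_map_twist:
  "continuous_map (prod_topology chabauty_fell euclidean) chabauty_fell
     (\<lambda>(Q, f :: 'g::discrete_topology \<Rightarrow> real). twist Q f)"
  (is "continuous_map ?X _ ?T")
proof (rule continuous_map_into_chabauty_fell)
  show "closed (?T x)" if "x \<in> topspace ?X" for x
    using that by (auto simp: topspace_chabauty_fell intro: closed_twist)
  fix L :: "('g \<times> real) set" assume L: "compact L"
  show "openin ?X {x \<in> topspace ?X. ?T x \<inter> L = {}}"
    unfolding openin_prod_topology_alt
  proof (intro allI impI)
    fix Q0 and f0 :: "'g \<Rightarrow> real"
    assume "(Q0, f0) \<in> {x \<in> topspace ?X. ?T x \<inter> L = {}}"
    then have Q0: "closed Q0" "twist Q0 f0 \<inter> L = {}" by (auto simp: topspace_chabauty_fell)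
    \<comment> \<open>\<open>twist Q0 f0\<close> misses \<open>L\<close> exactly if \<open>Q0\<close> misses \<open>L'\<close>; there is room \<open>e\<close> for perturbing \<open>Q0\<close> and \<open>f0\<close>\<close>
    define L' where "L' = (\<lambda>x. f0 (fst x) + snd x) ` L"
    have "compact L'"
      unfolding L'_def
      by (intro compact_continuous_image L continuous_intros
          continuous_on_compose2[OF Topological_Spaces.continuous_on_discrete continuous_on_fst]) auto
    moreover have "L' \<inter> Q0 = {}" using Q0(2) by (auto simp: L'_def twist_def)
    ultimately obtain e where e: "0 < e" "\<And>x y. x \<in> L' \<Longrightarrow> y \<in> Q0 \<Longrightarrow> e \<le> dist x y"
      using separate_compact_closed[OF _ Q0(1)] by metis
    define N where "N = {x + y | x y. x \<in> L' \<and> y \<in> cball 0 (e/2)}"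
    have N: "compact N"
      unfolding N_def by (intro compact_sums \<open>compact L'\<close> compact_cball)
    have fin: "finite (fst ` L)"
      by (intro finite_compact_discrete compact_continuous_image L continuous_intros)
    let ?W = "{C. closed C \<and> C \<inter> N = {}}"
    let ?V = "\<Inter>x\<in>fst ` L. {f :: 'g \<Rightarrow> real. \<bar>f x - f0 x\<bar> < e/2}"
    have "open ?V"
      by (intro open_INT fin ballI open_Collect_less continuous_intros continuous_on_product_coordinates)
    moreover have "z \<notin> N" if z: "z \<in> Q0" for z
    proof
      assume "z \<in> N"
      then obtain x y where xy: "z = x + y" "x \<in> L'" "\<bar>y\<bar> \<le> e/2"
        by (auto simp: N_def)
      then have "e \<le> \<bar>y\<bar>" using e(2)[OF xy(2) z] by (simp add: dist_real_def)
      then show False using xy(3) e(1) by simp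
    qed
    then have "Q0 \<in> ?W" using Q0(1) by auto
    moreover have "f0 \<in> ?V" using e by simp
    moreover have "(Q, f) \<in> {x \<in> topspace ?X. ?T x \<inter> L = {}}" if "Q \<in> ?W" and f: "f \<in> ?V" for Q f
    proof -
      have Q: "closed Q" "Q \<inter> N = {}" using that by auto
      have "f x + t \<notin> Q" if "(x, t) \<in> L" for x t
      proof -
        have "\<bar>f x - f0 x\<bar> < e/2" using f that by force
        then have "f x - f0 x \<in> cball 0 (e/2)" by (simp add: dist_real_def abs_minus_commute)
        moreover have "f0 x + t \<in> L'" using that by (force simp: L'_def)
        ultimately have "(f0 x + t) + (f x - f0 x) \<in> N" unfolding N_def by blast
        then have "f x + t \<in> N" by (simp add: algebra_simps)
        then show ?thesis using Q(2) by auto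
      qed
      then show ?thesis using Q(1) by (auto simp: topspace_chabauty_fell mem_twist)
    qed
    then have "?W \<times> ?V \<subseteq> {x \<in> topspace ?X. ?T x \<inter> L = {}}" by (intro subrelI) blast
    ultimately show "\<exists>W V. openin chabauty_fell W \<and> openin euclidean V \<and> Q0 \<in> W \<and> f0 \<in> V \<and>
        W \<times> V \<subseteq> {x \<in> topspace ?X. ?T x \<inter> L = {}}"
      using openin_chabauty_fell_miss[OF N] unfolding open_openin[symmetric]
      by (intro exI[of _ ?W] exI[of _ ?V] conjI)
  qed
next
  fix U :: "('g \<times> real) set" assume U: "open U"
  show "openin ?X {x \<in> topspace ?X. ?T x \<inter> U \<noteq> {}}"
    unfolding openin_prod_topology_alt
  proof (intro allI impI)
    fix Q0 and f0 :: "'g \<Rightarrow> real"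
    assume "(Q0, f0) \<in> {x \<in> topspace ?X. ?T x \<inter> U \<noteq> {}}"
    then obtain x t where Q0: "closed Q0" and xt: "(x, t) \<in> U" "f0 x + t \<in> Q0"
      by (auto simp: mem_twist topspace_chabauty_fell)
    have "open (Pair x -` U)" by (intro open_vimage U continuous_intros)
    then obtain e where e: "0 < e" "ball t e \<subseteq> Pair x -` U"
      using xt(1) unfolding open_contains_ball by blast
    let ?B = "ball (f0 x + t) (e/2)"
    let ?W = "{C. closed C \<and> C \<inter> ?B \<noteq> {}}"
    let ?V = "{f :: 'g \<Rightarrow> real. \<bar>f x - f0 x\<bar> < e/2}"
    have "open ?V"
      by (intro open_Collect_less continuous_intros continuous_on_product_coordinates)
    moreover have "f0 x + t \<in> ?B" using e by simp
    then have "Q0 \<in> ?W" using Q0 xt by blast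
    moreover have "f0 \<in> ?V" using e by simp
    moreover have "(Q, f) \<in> {x \<in> topspace ?X. ?T x \<inter> U \<noteq> {}}" if "Q \<in> ?W" and "f \<in> ?V" for Q f
    proof -
      from that obtain z where z: "z \<in> Q" "\<bar>f0 x + t - z\<bar> < e/2" by (auto simp: dist_real_def)
      have "\<bar>t - (z - f x)\<bar> < e" using z(2) that(2) by (simp only: mem_Collect_eq)
      then have "(x, z - f x) \<in> U" using e(2) by (auto simp: dist_real_def)
      moreover have "(x, z - f x) \<in> twist Q f" using z(1) by (simp add: mem_twist)
      ultimately show ?thesis using that(1) by (auto simp: topspace_chabauty_fell)
    qed
    then have "?W \<times> ?V \<subseteq> {x \<in> topspace ?X. ?T x \<inter> U \<noteq> {}}" by (intro subrelI) blast
    ultimately show "\<exists>W V. openin chabauty_fell W \<and> openin euclidean V \<and> Q0 \<in> W \<and> f0 \<in> V \<and>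
        W \<times> V \<subseteq> {x \<in> topspace ?X. ?T x \<inter> U \<noteq> {}}"
      using openin_chabauty_fell_hit[OF open_ball, of "f0 x + t" "e/2"] unfolding open_openin[symmetric]
      by (intro exI[of _ ?W] exI[of _ ?V] conjI)
  qed
qed

lemma twist_in_orbit_closure:
  fixes \<phi> :: "'g::{group_add, discrete_topology} \<Rightarrow> real"
  assumes "Q \<in> orbit_closure P" and "f \<in> closure (range (\<lambda>g. fiber_act g \<phi>))"
  shows "twist Q f \<in> orbit_closure (twist P \<phi>)"
proof -
  let ?S = "range (\<lambda>s. translate s P) \<times> range (\<lambda>g. fiber_act g \<phi>)"
  have "(Q, f) \<in> prod_topology chabauty_fell euclidean closure_of ?S"
    using assms by (simp add: closure_of_Times orbit_closure_def)
  then have "twist Q f \<in> chabauty_fell closure_of ((\<lambda>(Q, f). twist Q f) ` ?S)"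
    using continuous_map_image_closure_subset[OF continuous_map_twist] by fastforce
  moreover have "(\<lambda>(Q, f). twist Q f) ` ?S \<subseteq> range (\<lambda>g. translate g (twist P \<phi>))"
  proof clarify
    fix s g
    have "twist (translate s P) (fiber_act g \<phi>) = translate (g, s - \<phi> g) (twist P \<phi>)"
      by (simp add: twist_translate)
    then show "twist (translate s P) (fiber_act g \<phi>) \<in> range (\<lambda>g. translate g (twist P \<phi>))"
      by blast
  qed
  ultimately show ?thesis
    unfolding orbit_closure_def using closure_of_mono by blast
qed

section \<open>The Borel structure of hulls\<close>

text \<open>The sets whose fibre over \<open>\<gamma>\<close> meets the open interval from \<open>r\<close> to \<open>s\<close>.\<close>

definition hits :: "'g \<Rightarrow> real \<Rightarrow> real \<Rightarrow> ('g \<times> real) set set" where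
  "hits \<gamma> r s = {C. \<exists>t. r < t \<and> t < s \<and> (\<gamma>, t) \<in> C}"

lemma hits_alt: "hits \<gamma> r s = {C. C \<inter> {\<gamma>} \<times> {r<..<s} \<noteq> {}}"
  by (auto simp: hits_def)

lemma openin_hits:
  "openin chabauty_fell {C. closed C \<and> C \<in> hits (\<gamma> :: 'g::discrete_topology) r s}"
proof -
  have "open ({\<gamma>} \<times> {r<..<s})" by (intro open_Times discrete_topology_class.open_discrete open_greaterThanLessThan)
  then show ?thesis
    unfolding hits_alt using openin_chabauty_fell_hit by simp
qed

lemma hits_sets:
  fixes \<Omega> :: "('g::discrete_topology \<times> real) set set"
  assumes "\<And>C. C \<in> \<Omega> \<Longrightarrow> closed C"
  shows "{C \<in> \<Omega>. C \<in> hits \<gamma> r s} \<in> sets (borel_algebra_on \<Omega>)"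
proof -
  have "{C \<in> \<Omega>. C \<in> hits \<gamma> r s} = {C. closed C \<and> C \<in> hits \<gamma> r s} \<inter> \<Omega>"
    using assms by auto
  then show ?thesis using openin_sets_borel_algebra_on[OF openin_hits] by simp
qed

text \<open>The sets hitting all boxes of one finite list and missing all boxes of another. With rational
  endpoints there are countably many cells when the group is countable.\<close>

definition cell :: "('g \<times> rat \<times> rat) list \<Rightarrow> ('g \<times> rat \<times> rat) list \<Rightarrow> ('g \<times> real) set set" where
  "cell L1 L2 = {C. (\<forall>(\<gamma>, r, s)\<in>set L1. C \<in> hits \<gamma> (of_rat r) (of_rat s)) \<and>
     (\<forall>(\<gamma>, r, s)\<in>set L2. C \<notin> hits \<gamma> (of_rat r) (of_rat s))}"

lemma open_contains_rational_box:
  fixes V :: "('g::discrete_topology \<times> real) set"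
  assumes "open V" "(\<gamma>, t) \<in> V"
  obtains r s :: rat where "of_rat r < t" "t < of_rat s" "{\<gamma>} \<times> {of_rat r<..<of_rat s} \<subseteq> V"
proof -
  have "open (Pair \<gamma> -` V)" by (intro open_vimage assms continuous_intros)
  then obtain e where e: "0 < e" "ball t e \<subseteq> Pair \<gamma> -` V"
    using assms(2) unfolding open_contains_ball by blast
  obtain r where r: "t - e < of_rat r" "of_rat r < t" using of_rat_dense[of "t - e" t] e(1) by auto
  obtain s where s: "t < of_rat s" "of_rat s < t + e" using of_rat_dense[of t "t + e"] e(1) by auto
  have "{of_rat r<..<of_rat s} \<subseteq> ball t e" using r s by (auto simp: dist_real_def)
  then show thesis using e(2) r s by (intro that[of r s]) auto
qed

text \<open>Every open set is, on closed sets, a union of cells. Cells need not be open, since they may require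
  missing an open box; only their being countably many and Borel matters.\<close>

lemma cell_inside_open:
  fixes U :: "('g::discrete_topology \<times> real) set set"
  assumes "openin chabauty_fell U" and "C \<in> U"
  shows "\<exists>L1 L2. C \<in> cell L1 L2 \<and> (\<forall>D\<in>cell L1 L2. closed D \<longrightarrow> D \<in> U)"
proof -
  have "generate_topology_on
     ({{C::('g \<times> real) set. closed C \<and> C \<inter> K = {}} | K. compact K} \<union> {{C. closed C \<and> C \<inter> U \<noteq> {}} | U. open U}) U"
    using assms(1) unfolding chabauty_fell_def openin_topology_generated_by_iff .
  then show ?thesis using assms(2)
  proof induction
    case (Int A B)
    obtain L1 L2 where 1: "C \<in> cell L1 L2" "\<forall>D\<in>cell L1 L2. closed D \<longrightarrow> D \<in> A" using Int.IH(1) Int.prems by auto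
    obtain L3 L4 where 2: "C \<in> cell L3 L4" "\<forall>D\<in>cell L3 L4. closed D \<longrightarrow> D \<in> B" using Int.IH(2) Int.prems by auto
    have "cell (L1 @ L3) (L2 @ L4) = cell L1 L2 \<inter> cell L3 L4" by (auto simp: cell_def ball_Un)
    then have "C \<in> cell (L1 @ L3) (L2 @ L4) \<and>
        (\<forall>D\<in>cell (L1 @ L3) (L2 @ L4). closed D \<longrightarrow> D \<in> A \<inter> B)"
      using 1 2 by (simp only: Int_iff) blast
    then show ?case by blast
  next
    case (UN K)
    then obtain A where "A \<in> K" "C \<in> A" by auto
    then obtain L1 L2 where "C \<in> cell L1 L2" "\<forall>D\<in>cell L1 L2. closed D \<longrightarrow> D \<in> A"
      using UN.IH[of A] by auto
    then show ?case using \<open>A \<in> K\<close> by blast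
  next
    case (Basis S)
    then consider K where "compact K" "S = {C. closed C \<and> C \<inter> K = {}}"
      | V where "open V" "S = {C. closed C \<and> C \<inter> V \<noteq> {}}" by auto
    then show ?case
    proof cases
      case (1 K)
      then have C: "closed C" "C \<inter> K = {}" using Basis by auto
      let ?box = "\<lambda>(\<gamma>::'g, r::rat, s::rat). {\<gamma>} \<times> {of_rat r<..<of_rat s :: real}"
      let ?B = "{b. ?box b \<subseteq> - C}"
      have "K \<subseteq> (\<Union>b\<in>?B. ?box b)"
      proof
        fix x assume "x \<in> K"
        then have "open (- C)" "(fst x, snd x) \<in> - C" using C by auto
        then obtain r s where "of_rat r < snd x" "snd x < of_rat s"
          "{fst x} \<times> {of_rat r<..<of_rat s} \<subseteq> - C" by (rule open_contains_rational_box)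
        then show "x \<in> (\<Union>b\<in>?B. ?box b)"
          by (intro UN_I[of "(fst x, r, s)"]) (auto simp: mem_Times_iff)
      qed
      moreover have "open (?box b)" for b
        by (auto split: prod.split intro!: open_Times discrete_topology_class.open_discrete)
      ultimately obtain B where B: "B \<subseteq> ?B" "finite B" "K \<subseteq> (\<Union>b\<in>B. ?box b)"
        using compactE_image[OF 1(1), of ?B ?box] by metis
      obtain L where L: "set L = B" using finite_list[OF B(2)] by auto
      have "C \<notin> hits \<gamma> (of_rat r) (of_rat s)" if "(\<gamma>, r, s) \<in> set L" for \<gamma> r s
      proof -
        have "(\<gamma>, r, s) \<in> ?B" using that B(1) L by auto
        then have "{\<gamma>} \<times> {of_rat r<..<of_rat s} \<subseteq> - C" by simp
        then show ?thesis unfolding hits_alt by blast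
      qed
      then have "C \<in> cell [] L" by (auto simp: cell_def)
      moreover have "D \<in> S" if D: "D \<in> cell [] L" "closed D" for D
      proof -
        have "x \<notin> D" if "x \<in> K" for x
        proof -
          obtain y where "y \<in> B" "x \<in> ?box y" using subsetD[OF B(3) \<open>x \<in> K\<close>] by (rule UN_E)
          then obtain \<gamma> r s where b: "(\<gamma>, r, s) \<in> set L" "x \<in> ?box (\<gamma>, r, s)"
            using L by (cases y) auto
          have "D \<notin> hits \<gamma> (of_rat r) (of_rat s)" using D(1) b(1) by (auto simp: cell_def)
          then show ?thesis using b(2) by (auto simp: hits_def)
        qed
        then show ?thesis using D(2) 1(2) by auto
      qed
      ultimately show ?thesis by blast
    next
      case (2 V)
      then have "C \<inter> V \<noteq> {}" using Basis by auto
      then obtain \<gamma> t where t: "(\<gamma>, t) \<in> C" "(\<gamma>, t) \<in> V" by auto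
      obtain r s where rs: "of_rat r < t" "t < of_rat s" "{\<gamma>} \<times> {of_rat r<..<of_rat s} \<subseteq> V"
        using open_contains_rational_box[OF 2(1) t(2)] .
      have "C \<in> cell [(\<gamma>, r, s)] []" using t rs by (auto simp: cell_def hits_def)
      moreover have "D \<in> S" if "D \<in> cell [(\<gamma>, r, s)] []" "closed D" for D
      proof -
        have "D \<in> hits \<gamma> (of_rat r) (of_rat s)" using that(1) by (simp add: cell_def)
        then have "D \<inter> V \<noteq> {}" using rs(3) unfolding hits_alt by blast
        then show ?thesis using that(2) 2(2) by simp
      qed
      ultimately show ?thesis by blast
    qed
  qed simp
qed

text \<open>Consequently the Borel sets of a space of closed sets are generated by the hitting sets.\<close>

lemma measurable_borel_algebra_on:
  fixes \<Omega> :: "('g::{countable, discrete_topology} \<times> real) set set"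
  assumes cl: "\<And>C. C \<in> \<Omega> \<Longrightarrow> closed C"
    and f: "\<And>x. x \<in> space N \<Longrightarrow> f x \<in> \<Omega>"
    and hit: "\<And>\<gamma> r s. {x \<in> space N. f x \<in> hits \<gamma> r s} \<in> sets N"
  shows "f \<in> measurable N (borel_algebra_on \<Omega>)"
proof -
  have "f \<in> measurable N (sigma \<Omega> {U. openin (subtopology chabauty_fell \<Omega>) U})"
  proof (rule measurable_measure_of[OF borel_algebra_on_generators])
    show "f \<in> space N \<rightarrow> \<Omega>" using f by auto
    fix A assume "A \<in> {U. openin (subtopology chabauty_fell \<Omega>) U}"
    then obtain V where V: "openin chabauty_fell V" "A = V \<inter> \<Omega>"
      by (auto simp: openin_subtopology)
    let ?I = "{(L1, L2). \<forall>D\<in>cell L1 L2. closed D \<longrightarrow> D \<in> V}"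
    have cells: "{x \<in> space N. f x \<in> cell L1 L2} \<in> sets N" for L1 L2
      unfolding cell_def mem_Collect_eq
      by (intro sets.sets_Collect_conj sets.sets_Collect_finite_All)
         (auto simp: pred_def split: prod.splits intro!: hit sets.sets_Collect_neg)
    have "f -` A \<inter> space N = (\<Union>(L1, L2)\<in>?I. {x \<in> space N. f x \<in> cell L1 L2})"
    proof (intro equalityI subsetI)
      fix x assume "x \<in> f -` A \<inter> space N"
      then show "x \<in> (\<Union>(L1, L2)\<in>?I. {x \<in> space N. f x \<in> cell L1 L2})"
        using cell_inside_open[OF V(1), of "f x"] V(2) by auto
    qed (use f cl V(2) in auto)
    also have "\<dots> \<in> sets N"
      by (intro sets.countable_UN') (use cells in auto)
    finally show "f -` A \<inter> space N \<in> sets N" .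
  qed
  then show ?thesis by (simp add: borel_algebra_on_def)
qed

section \<open>Rounding a quasimorphism\<close>

lemma quasimorphism_defect:
  assumes "quasimorphism \<phi>"
  obtains D where "0 \<le> D" "\<And>g h. \<bar>\<phi> (g + h) - \<phi> g - \<phi> h\<bar> \<le> D"
proof -
  obtain D where D: "\<And>x. x \<in> range (\<lambda>(g, h). \<bar>\<phi> (g + h) - \<phi> g - \<phi> h\<bar>) \<Longrightarrow> x \<le> D"
    using assms unfolding quasimorphism_def bdd_above_def by blast
  have D': "\<bar>\<phi> (g + h) - \<phi> g - \<phi> h\<bar> \<le> D" for g h
    by (rule D) (auto intro: image_eqI[where x = "(g, h)"])
  then have "0 \<le> D" by (meson abs_ge_zero order_trans)
  then show thesis using D' by (rule that)
qed

lemma quasimorphismI: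
  assumes "\<phi> 0 = 0" "\<And>g h. \<bar>\<phi> (g + h) - \<phi> g - \<phi> h\<bar> \<le> D"
  shows "quasimorphism \<phi>"
  using assms by (auto simp: quasimorphism_def bdd_above_def)

lemma quasimorphism_unbounded_above:
  fixes \<phi> :: "'g::group_add \<Rightarrow> real"
  assumes \<phi>: "quasimorphism \<phi>"
    and far: "\<not> (\<exists>\<psi>. real_homomorphism \<psi> \<and> bounded_distance \<phi> \<psi>)"
  obtains g where "\<phi> g > B"
proof -
  obtain D where D: "0 \<le> D" "\<And>g h. \<bar>\<phi> (g + h) - \<phi> g - \<phi> h\<bar> \<le> D"
    using quasimorphism_defect[OF \<phi>] by blast
  have "\<not> bounded_distance \<phi> (\<lambda>_. 0)"
  proof
    assume "bounded_distance \<phi> (\<lambda>_. 0)"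
    moreover have "real_homomorphism (\<lambda>_::'g. 0)" by (simp add: real_homomorphism_def)
    ultimately show False using far by blast
  qed
  then obtain g where g: "\<bar>\<phi> g\<bar> > \<bar>B\<bar> + D"
    unfolding bounded_distance_def bounded_iff by (auto simp: not_le)
  have "\<bar>\<phi> (- g) + \<phi> g\<bar> \<le> D"
    using D(2)[of "- g" g] \<phi> by (simp add: quasimorphism_def)
  then have "\<phi> g > B \<or> \<phi> (- g) > B" using g by arith
  then show thesis using that by auto
qed

text \<open>The values on multiples of one element climb in steps of bounded size, so they are coarsely
  dense in the half-line.\<close>

lemma quasimorphism_coarsely_dense:
  fixes \<phi> :: "'g::group_add \<Rightarrow> real"
  assumes \<phi>: "quasimorphism \<phi>"
    and far: "\<not> (\<exists>\<psi>. real_homomorphism \<psi> \<and> bounded_distance \<phi> \<psi>)"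
  obtains L where "\<And>T. 0 < T \<Longrightarrow> \<exists>g. T \<le> \<phi> g \<and> \<phi> g \<le> T + L"
proof -
  obtain D where D: "0 \<le> D" "\<And>g h. \<bar>\<phi> (g + h) - \<phi> g - \<phi> h\<bar> \<le> D"
    using quasimorphism_defect[OF \<phi>] by blast
  obtain g where g: "\<phi> g > D + 1" using quasimorphism_unbounded_above[OF \<phi> far] .
  define a where "a k = ((+) g ^^ k) 0" for k :: nat
  have a0: "\<phi> (a 0) = 0" using \<phi> by (simp add: a_def quasimorphism_def)
  have step: "\<bar>\<phi> (a (Suc k)) - \<phi> g - \<phi> (a k)\<bar> \<le> D" for k
    using D(2)[of g "a k"] by (simp add: a_def)
  have grow: "real k \<le> \<phi> (a k)" for k
  proof (induction k)
    case (Suc k)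
    then show ?case using step[of k] g by (simp add: abs_le_iff)
  qed (simp add: a0)
  have "\<exists>h. T \<le> \<phi> h \<and> \<phi> h \<le> T + (\<phi> g + D)" if T: "0 < T" for T
  proof -
    obtain k :: nat where "T \<le> real k" using real_arch_simple by blast
    then have ex: "\<exists>k. T \<le> \<phi> (a k)" using grow order_trans by blast
    define k where "k = (LEAST k. T \<le> \<phi> (a k))"
    have k: "T \<le> \<phi> (a k)" unfolding k_def by (rule LeastI_ex[OF ex])
    then have "k \<noteq> 0" using T a0 by (metis not_le)
    then obtain j where j: "k = Suc j" using not0_implies_Suc by blast
    have "\<not> T \<le> \<phi> (a j)" using not_less_Least[of j "\<lambda>k. T \<le> \<phi> (a k)"] j by (simp flip: k_def)
    then have "\<phi> (a k) \<le> T + (\<phi> g + D)" using step[of j] j by (simp add: abs_le_iff)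
    then show ?thesis using k by blast
  qed
  then show thesis by (rule that)
qed

text \<open>Rounding down to a multiple of a step that depends on the argument: the step is \<open>c m\<close> on the interval
  from \<open>m\<^sup>2\<close> to \<open>(m + 1)\<^sup>2\<close>. The lengths of these intervals tend to infinity.\<close>

definition round_to :: "(nat \<Rightarrow> real) \<Rightarrow> real \<Rightarrow> real" where
  "round_to c t = c (nat \<lfloor>sqrt t\<rfloor>) * of_int \<lfloor>t / c (nat \<lfloor>sqrt t\<rfloor>)\<rfloor>"

lemma round_to_close:
  assumes "\<And>m. 1 \<le> c m \<and> c m \<le> 2"
  shows "\<bar>round_to c t - t\<bar> \<le> 2"
proof -
  define s where "s = c (nat \<lfloor>sqrt t\<rfloor>)"
  have s: "1 \<le> s" "s \<le> 2" using assms by (auto simp: s_def)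
  have "s * of_int \<lfloor>t / s\<rfloor> \<le> s * (t / s)"
    using s by (intro mult_left_mono of_int_floor_le) auto
  moreover have "s * (t / s) < s * (of_int \<lfloor>t / s\<rfloor> + 1)"
    using s by (intro mult_strict_left_mono) (auto intro: floor_correct[THEN conjunct2])
  moreover have "s * (t / s) = t" using s by simp
  ultimately have "s * of_int \<lfloor>t / s\<rfloor> \<le> t" "t < s * of_int \<lfloor>t / s\<rfloor> + s"
    using s by (simp_all add: distrib_left)
  then show ?thesis using s by (simp add: round_to_def flip: s_def)
qed

lemma round_to_window:
  assumes "real m ^ 2 \<le> t" "t < (real m + 1) ^ 2"
  shows "round_to c t = c m * of_int \<lfloor>t / c m\<rfloor>"
proof -
  have "real m \<le> sqrt t" using assms(1) by (rule real_le_rsqrt)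
  moreover have "sqrt t < real m + 1" using assms(2) by (intro real_less_lsqrt) auto
  ultimately have "\<lfloor>sqrt t\<rfloor> = int m" by (simp add: floor_eq_iff)
  then show ?thesis by (simp add: round_to_def)
qed

text \<open>A sequence for which every point of \<open>[1, 2]\<close> is a cluster point: an enumeration of the rationals,
  clamped to \<open>[1, 2]\<close>, in which every rational recurs infinitely often.\<close>

lemma recurrent_dense_sequence:
  obtains c :: "nat \<Rightarrow> real" where "\<And>m. 1 \<le> c m \<and> c m \<le> 2"
    "\<And>x e N. x \<in> {1..2} \<Longrightarrow> 0 < e \<Longrightarrow> \<exists>m\<ge>N. \<bar>c m - x\<bar> < e"
proof
  define c :: "nat \<Rightarrow> real" where "c m = max 1 (min 2 (of_rat (from_nat (fst (prod_decode m)))))" for m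
  show "1 \<le> c m \<and> c m \<le> 2" for m by (simp add: c_def)
  fix x e :: real and N :: nat assume x: "x \<in> {1..2}" and e: "0 < e"
  obtain r :: rat where r: "x - e < of_rat r" "of_rat r < x + e"
    using of_rat_dense[of "x - e" "x + e"] e by auto
  let ?m = "prod_encode (to_nat r, N)"
  have "\<bar>max 1 (min 2 s) - x\<bar> < e" if "x - e < s" "s < x + e" for s :: real
    using that x by (auto simp: max_def min_def)
  then have "\<bar>c ?m - x\<bar> < e" using r by (simp add: c_def)
  then show "\<exists>m\<ge>N. \<bar>c m - x\<bar> < e" using le_prod_encode_2 by blast
qed

section \<open>Limits with values in a lattice\<close>

text \<open>The function with values in \<open>c\<int>\<close> coded by an integer-valued one.\<close>

abbreviation scaled :: "real \<Rightarrow> ('g \<Rightarrow> int) \<Rightarrow> 'g \<Rightarrow> real" where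
  "scaled c k \<equiv> (\<lambda>x. c * of_int (k x))"

text \<open>
  The pointwise limits of normalised translates of \<open>\<phi>\<close> with values in \<open>c\<int>\<close>, divided by \<open>c\<close>. Coding them
  by integer-valued functions gives a compact space of functions into a discrete space.
\<close>

definition integral_limits :: "real \<Rightarrow> ('g::group_add \<Rightarrow> real) \<Rightarrow> ('g \<Rightarrow> int) set" where
  "integral_limits c \<phi> = {k. scaled c k \<in> closure (range (\<lambda>g. fiber_act g \<phi>))}"

lemma fiber_act_fiber_act: "fiber_act g (fiber_act h f) = fiber_act (g + h) (f :: _ \<Rightarrow> 'b::ab_group_add)"
  by (auto simp: fiber_act_def add.assoc)

lemma integral_limits_0:
  assumes "k \<in> integral_limits c \<phi>" "c \<noteq> 0"
  shows "k 0 = 0"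
proof -
  have "closure (range (\<lambda>g. fiber_act g \<phi>)) \<subseteq> {f. f 0 = 0}"
    by (intro closure_minimal closed_Collect_eq continuous_intros continuous_on_product_coordinates)
       (auto simp: fiber_act_def)
  then show ?thesis using assms by (auto simp: integral_limits_def)
qed

lemma integral_limits_close:
  assumes "k \<in> integral_limits c \<phi>" "\<And>g h. \<bar>\<phi> (g + h) - \<phi> g - \<phi> h\<bar> \<le> D"
  shows "\<bar>c * of_int (k x) - \<phi> x\<bar> \<le> D"
proof -
  have "closure (range (\<lambda>g. fiber_act g \<phi>)) \<subseteq> {f. \<bar>f x - \<phi> x\<bar> \<le> D}"
  proof (intro closure_minimal closed_Collect_le continuous_intros continuous_on_product_coordinates)
    show "range (\<lambda>g. fiber_act g \<phi>) \<subseteq> {f. \<bar>f x - \<phi> x\<bar> \<le> D}"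
    proof clarify
      fix g
      show "\<bar>fiber_act g \<phi> x - \<phi> x\<bar> \<le> D"
        using assms(2)[of x g] by (simp add: fiber_act_def algebra_simps)
    qed
  qed
  then show ?thesis using assms(1) by (auto simp: integral_limits_def)
qed

lemma integral_limits_act:
  assumes "k \<in> integral_limits c \<phi>"
  shows "fiber_act g k \<in> integral_limits c \<phi>"
proof -
  let ?S = "range (\<lambda>g. fiber_act g \<phi>)"
  have "continuous_on UNIV (fiber_act g :: ('a \<Rightarrow> real) \<Rightarrow> 'a \<Rightarrow> real)"
    unfolding fiber_act_def
    by (intro continuous_on_coordinatewise_then_product continuous_intros continuous_on_product_coordinates)
  then have "continuous_on (closure ?S) (fiber_act g)" by (rule continuous_on_subset) simp
  moreover have "fiber_act g ` ?S \<subseteq> ?S" by (auto simp: fiber_act_fiber_act)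
  then have "fiber_act g ` ?S \<subseteq> closure ?S" using closure_subset by (rule order_trans)
  ultimately have "fiber_act g ` closure ?S \<subseteq> closure ?S"
    by (intro image_closure_subset closed_closure)
  moreover have "scaled c (fiber_act g k) = fiber_act g (scaled c k)"
    by (simp add: fiber_act_def algebra_simps)
  ultimately show ?thesis using assms by (auto simp: integral_limits_def)
qed

lemma fun_tendsto_coordinate:
  fixes f :: "nat \<Rightarrow> 'a \<Rightarrow> 'b::topological_space"
  assumes "f \<longlonglongrightarrow> l"
  shows "(\<lambda>n. f n x) \<longlonglongrightarrow> l x"
  using continuous_on_tendsto_compose[OF continuous_on_product_coordinates assms, of x] by simp

lemma compact_integral_limits:
  assumes "1 \<le> c" "\<And>g h. \<bar>\<phi> (g + h) - \<phi> g - \<phi> h\<bar> \<le> D"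
  shows "compact (integral_limits c \<phi>)"
proof -
  let ?N = "\<lambda>x. \<lceil>\<bar>\<phi> x\<bar> + D\<rceil>"
  let ?box = "{k. \<forall>x. k x \<in> {- ?N x .. ?N x}}"
  have "continuous_on UNIV (scaled c :: ('a \<Rightarrow> int) \<Rightarrow> _)"
    by (intro continuous_on_coordinatewise_then_product continuous_intros continuous_on_product_coordinates)
  then have "closed (scaled c -` closure (range (\<lambda>g. fiber_act g \<phi>)))"
    by (intro closed_vimage closed_closure)
  then have "compact (?box \<inter> (scaled c -` closure (range (\<lambda>g. fiber_act g \<phi>))))"
    by (intro compact_Int_closed compact_product_box) (auto intro: finite_imp_compact)
  moreover have "k \<in> ?box" if "k \<in> integral_limits c \<phi>" for k
  proof -
    have "\<bar>k x\<bar> \<le> ?N x" for x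
    proof -
      have "\<bar>real_of_int (k x)\<bar> \<le> c * \<bar>real_of_int (k x)\<bar>" using assms(1) by (simp add: mult_le_cancel_right1)
      also have "\<dots> = \<bar>c * of_int (k x)\<bar>" using assms(1) by (simp add: abs_mult)
      also have "\<dots> \<le> \<bar>\<phi> x\<bar> + D" using integral_limits_close[OF that assms(2), of x] by arith
      finally show ?thesis by linarith
    qed
    then show ?thesis by (simp add: abs_le_iff minus_le_iff)
  qed
  then have "integral_limits c \<phi> = ?box \<inter> (scaled c -` closure (range (\<lambda>g. fiber_act g \<phi>)))"
    by (auto simp: integral_limits_def)
  ultimately show ?thesis by simp
qed

text \<open>For each \<open>n\<close> some translate of the rounded quasimorphism has, at the group elements with code below \<open>n\<close>, values
  that are multiples of a step within \<open>1 / Suc n\<close> of \<open>x\<close>. A subsequential limit has values in \<open>x\<int>\<close>.\<close>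

lemma integral_limits_nonempty:
  fixes \<phi> :: "'g::{group_add, countable} \<Rightarrow> real"
  assumes \<phi>: "quasimorphism \<phi>"
    and far: "\<not> (\<exists>\<psi>. real_homomorphism \<psi> \<and> bounded_distance \<phi> \<psi>)"
    and c: "\<And>m. 1 \<le> c m \<and> c m \<le> 2" "\<And>x e N. x \<in> {1..2} \<Longrightarrow> 0 < e \<Longrightarrow> \<exists>m\<ge>N. \<bar>c m - x\<bar> < e"
    and x: "x \<in> {1..2}"
    and D': "\<And>g h. \<bar>round_to c (\<phi> (g + h)) - round_to c (\<phi> g) - round_to c (\<phi> h)\<bar> \<le> D'"
  shows "integral_limits x (round_to c \<circ> \<phi>) \<noteq> {}"
proof -
  let ?\<phi>' = "round_to c \<circ> \<phi>"
  obtain D where D: "0 \<le> D" "\<And>g h. \<bar>\<phi> (g + h) - \<phi> g - \<phi> h\<bar> \<le> D"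
    using quasimorphism_defect[OF \<phi>] by blast
  obtain L where L: "\<And>T. 0 < T \<Longrightarrow> \<exists>g. T \<le> \<phi> g \<and> \<phi> g \<le> T + L"
    using quasimorphism_coarsely_dense[OF \<phi> far] by blast
  have "\<exists>g m. \<bar>c m - x\<bar> < 1 / Suc n \<and>
      (\<forall>y. to_nat y < n \<longrightarrow> (\<exists>j::int. fiber_act g ?\<phi>' y = c m * j))" for n
  proof -
    have "finite {y::'g. to_nat y < n}"
      by (rule inj_on_finite[of to_nat _ "{..<n}"]) (auto simp: inj_on_def)
    then obtain R where R: "\<And>y. to_nat y < n \<Longrightarrow> \<bar>\<phi> y\<bar> \<le> R" "0 \<le> R"
    proof -
      assume fin: "finite {y::'g. to_nat y < n}" and *: "\<And>R. (\<And>y. to_nat y < n \<Longrightarrow> \<bar>\<phi> y\<bar> \<le> R) \<Longrightarrow> 0 \<le> R \<Longrightarrow> thesis"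
      let ?R = "\<Sum>y\<in>{y::'g. to_nat y < n}. \<bar>\<phi> y\<bar>"
      show thesis
        by (rule *[of ?R]) (use fin in \<open>auto intro!: member_le_sum sum_nonneg\<close>)
    qed
    \<comment> \<open>the window from \<open>m\<^sup>2\<close> to \<open>(m + 1)\<^sup>2\<close> has length above \<open>2 m\<close>; its length must exceed \<open>2 (R + D) + L\<close>\<close>
    obtain N :: nat where N: "2 * (R + D) + \<bar>L\<bar> + 1 < real N" using reals_Archimedean2 by blast
    obtain m where m: "m \<ge> N" "\<bar>c m - x\<bar> < 1 / Suc n" using c(2)[OF x, of "1 / Suc n" N] by auto
    then have mN: "2 * (R + D) + \<bar>L\<bar> + 1 < real m" using N by linarith
    have "0 < real m ^ 2 + (R + D)" using mN R(2) D(1) by (intro add_pos_nonneg) auto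
    then obtain g where g: "real m ^ 2 + (R + D) \<le> \<phi> g" "\<phi> g \<le> real m ^ 2 + (R + D) + L"
      using L by blast
    have "real m ^ 2 + 2 * (R + D) + \<bar>L\<bar> < (real m + 1) ^ 2"
      using mN by (simp add: power2_eq_square algebra_simps)
    then have window: "real m ^ 2 \<le> t" "t < (real m + 1) ^ 2" if "\<bar>t - \<phi> g\<bar> \<le> R + D" for t
    proof -
      have "t - \<phi> g \<le> R + D" "\<phi> g - t \<le> R + D" using that by (auto simp: abs_le_iff)
      moreover have "\<phi> g \<le> real m ^ 2 + (R + D) + \<bar>L\<bar>" using g(2) abs_ge_self[of L] by linarith
      ultimately show "real m ^ 2 \<le> t" "t < (real m + 1) ^ 2"
        using g(1) \<open>real m ^ 2 + 2 * (R + D) + \<bar>L\<bar> < (real m + 1) ^ 2\<close>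
        by (simp_all only: distrib_left)
    qed
    have "fiber_act g ?\<phi>' y = c m * of_int (\<lfloor>\<phi> (y + g) / c m\<rfloor> - \<lfloor>\<phi> g / c m\<rfloor>)" if "to_nat y < n" for y
    proof -
      have "\<bar>\<phi> (y + g) - \<phi> g\<bar> \<le> R + D" using D(2)[of y g] R(1)[OF that] by linarith
      then have "round_to c (\<phi> (y + g)) = c m * of_int \<lfloor>\<phi> (y + g) / c m\<rfloor>"
        using window by (intro round_to_window) auto
      moreover have "round_to c (\<phi> g) = c m * of_int \<lfloor>\<phi> g / c m\<rfloor>"
        using window[of "\<phi> g"] R(2) D(1) by (intro round_to_window) auto
      ultimately show ?thesis by (simp add: fiber_act_def algebra_simps)
    qed
    then show ?thesis using m(2) by blast
  qed
  then obtain g m where gm: "\<And>n. \<bar>c (m n) - x\<bar> < 1 / Suc n"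
    "\<And>n y. to_nat y < n \<Longrightarrow> \<exists>j::int. fiber_act (g n) ?\<phi>' y = c (m n) * j" by metis
  have c_lim: "(\<lambda>n. c (m n)) \<longlonglongrightarrow> x"
  proof -
    have "(\<lambda>n. c (m n) - x) \<longlonglongrightarrow> 0"
      by (rule Lim_null_comparison[OF _ LIMSEQ_Suc[OF lim_1_over_n]])
         (use gm(1) in \<open>auto intro!: always_eventually less_imp_le\<close>)
    then show ?thesis by (simp add: LIM_zero_iff)
  qed
  let ?box = "{f. \<forall>y. f y \<in> {?\<phi>' y - D' .. ?\<phi>' y + D'}}"
  have "seq_compact ?box"
    by (intro compact_imp_seq_compact compact_product_box compact_Icc)
  moreover have "fiber_act (g n) ?\<phi>' \<in> ?box" for n
  proof -
    have "\<bar>fiber_act (g n) ?\<phi>' y - ?\<phi>' y\<bar> \<le> D'" for y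
      using D'[of y "g n"] by (simp add: fiber_act_def algebra_simps)
    then show ?thesis by (auto simp: abs_le_iff algebra_simps)
  qed
  ultimately obtain f r where f: "strict_mono r" "((\<lambda>n. fiber_act (g n) ?\<phi>') \<circ> r) \<longlonglongrightarrow> f"
    using seq_compactE[of ?box "\<lambda>n. fiber_act (g n) ?\<phi>'"] by blast
  have "f y / x \<in> \<int>" for y
  proof (rule Lim_in_closed_set[OF closed_Ints])
    have "(\<lambda>n. c (m (r n))) \<longlonglongrightarrow> x"
      using LIMSEQ_subseq_LIMSEQ[OF c_lim f(1)] by (simp add: o_def)
    moreover have "(\<lambda>n. fiber_act (g (r n)) ?\<phi>' y) \<longlonglongrightarrow> f y"
      using fun_tendsto_coordinate[OF f(2), of y] by (simp add: o_def)
    ultimately show "(\<lambda>n. fiber_act (g (r n)) ?\<phi>' y / c (m (r n))) \<longlonglongrightarrow> f y / x"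
      using x by (intro tendsto_divide) auto
    have "fiber_act (g (r n)) ?\<phi>' y / c (m (r n)) \<in> \<int>" if "n \<ge> Suc (to_nat y)" for n
    proof -
      have "to_nat y < r n" using that seq_suble[OF f(1), of n] by linarith
      then obtain j :: int where "fiber_act (g (r n)) ?\<phi>' y = c (m (r n)) * j" using gm(2) by blast
      then show ?thesis using c(1)[of "m (r n)"] by auto
    qed
    then show "\<forall>\<^sub>F n in sequentially. fiber_act (g (r n)) ?\<phi>' y / c (m (r n)) \<in> \<int>"
      unfolding eventually_sequentially by blast
  qed simp
  then have k: "f y / x = of_int \<lfloor>f y / x\<rfloor>" for y by (metis Ints_cases floor_of_int)
  have "f = scaled x (\<lambda>y. \<lfloor>f y / x\<rfloor>)"
  proof
    fix y
    show "f y = x * of_int \<lfloor>f y / x\<rfloor>" unfolding k[of y, symmetric] using x by simp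
  qed
  moreover have "f \<in> closure (range (\<lambda>g. fiber_act g ?\<phi>'))"
    by (rule Lim_in_closed_set[OF closed_closure _ _ f(2)])
       (auto intro!: always_eventually subsetD[OF closure_subset])
  ultimately have "(\<lambda>y. \<lfloor>f y / x\<rfloor>) \<in> integral_limits x ?\<phi>'"
    unfolding integral_limits_def mem_Collect_eq by argo
  then show ?thesis by blast
qed

section \<open>Sets determined by finitely many coordinates\<close>

text \<open>The subsets of \<open>K\<close> for which membership depends on finitely many values of the function.\<close>

definition finitely_determined :: "('g \<Rightarrow> 'b) set \<Rightarrow> ('g \<Rightarrow> 'b) set set" where
  "finitely_determined K = {A. A \<subseteq> K \<and>
     (\<exists>F. finite F \<and> (\<forall>k\<in>K. \<forall>k'\<in>K. (\<forall>x\<in>F. k x = k' x) \<longrightarrow> (k \<in> A \<longleftrightarrow> k' \<in> A)))}"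

text \<open>The functions in \<open>K\<close> with finitely many prescribed values. The prescriptions are lists, numbered by
  the coding of the countable type of lists; contradictory ones give the empty set.\<close>

definition cylinder :: "('g::countable \<Rightarrow> 'b::countable) set \<Rightarrow> nat \<Rightarrow> ('g \<Rightarrow> 'b) set" where
  "cylinder K n = {k \<in> K. \<forall>(x, j)\<in>set (from_nat n). k x = j}"

lemma finitely_determinedI:
  assumes "finite F" "A \<subseteq> K"
    and "\<And>k k'. k \<in> K \<Longrightarrow> k' \<in> K \<Longrightarrow> (\<And>x. x \<in> F \<Longrightarrow> k x = k' x) \<Longrightarrow> k \<in> A \<Longrightarrow> k' \<in> A"
  shows "A \<in> finitely_determined K"
proof -
  have "k \<in> A \<longleftrightarrow> k' \<in> A" if "k \<in> K" "k' \<in> K" "\<forall>x\<in>F. k x = k' x" for k k'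
    using assms(3)[of k k'] assms(3)[of k' k] that by metis
  then show ?thesis unfolding finitely_determined_def using assms(1,2) by blast
qed

lemma finitely_determinedE:
  assumes "A \<in> finitely_determined K"
  obtains F where "finite F" "A \<subseteq> K"
    "\<And>k k'. k \<in> K \<Longrightarrow> k' \<in> K \<Longrightarrow> (\<And>x. x \<in> F \<Longrightarrow> k x = k' x) \<Longrightarrow> k \<in> A \<Longrightarrow> k' \<in> A"
proof -
  obtain F where "finite F" "A \<subseteq> K"
    and F: "\<forall>k\<in>K. \<forall>k'\<in>K. (\<forall>x\<in>F. k x = k' x) \<longrightarrow> (k \<in> A \<longleftrightarrow> k' \<in> A)"
    using assms by (auto simp: finitely_determined_def)
  then show thesis by (intro that[of F]) blast+
qed

lemma algebra_finitely_determined: "algebra K (finitely_determined K)"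
  unfolding algebra_iff_Un
proof (intro conjI ballI)
  show "finitely_determined K \<subseteq> Pow K" by (auto simp: finitely_determined_def)
  show "{} \<in> finitely_determined K" by (rule finitely_determinedI[of "{}"]) auto
next
  fix A assume "A \<in> finitely_determined K"
  then obtain F where F: "finite F" "A \<subseteq> K"
    "\<And>k k'. k \<in> K \<Longrightarrow> k' \<in> K \<Longrightarrow> (\<And>x. x \<in> F \<Longrightarrow> k x = k' x) \<Longrightarrow> k \<in> A \<Longrightarrow> k' \<in> A"
    by (rule finitely_determinedE) blast
  show "K - A \<in> finitely_determined K"
  proof (rule finitely_determinedI[OF F(1)])
    fix k k' assume "k \<in> K" "k' \<in> K" "\<And>x. x \<in> F \<Longrightarrow> k x = k' x" "k \<in> K - A"
    then show "k' \<in> K - A" using F(3)[of k' k] by auto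
  qed auto
next
  fix A B assume "A \<in> finitely_determined K" "B \<in> finitely_determined K"
  then obtain F G where F: "finite F" "A \<subseteq> K"
    "\<And>k k'. k \<in> K \<Longrightarrow> k' \<in> K \<Longrightarrow> (\<And>x. x \<in> F \<Longrightarrow> k x = k' x) \<Longrightarrow> k \<in> A \<Longrightarrow> k' \<in> A"
    and G: "finite G" "B \<subseteq> K"
    "\<And>k k'. k \<in> K \<Longrightarrow> k' \<in> K \<Longrightarrow> (\<And>x. x \<in> G \<Longrightarrow> k x = k' x) \<Longrightarrow> k \<in> B \<Longrightarrow> k' \<in> B"
    by (elim finitely_determinedE) blast
  show "A \<union> B \<in> finitely_determined K"
  proof (rule finitely_determinedI[of "F \<union> G"])
    fix k k' assume "k \<in> K" "k' \<in> K" "\<And>x. x \<in> F \<union> G \<Longrightarrow> k x = k' x" "k \<in> A \<union> B"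
    then show "k' \<in> A \<union> B" using F(3)[of k k'] G(3)[of k k'] by auto
  qed (use F G in auto)
qed

lemma cylinder_finitely_determined: "cylinder K n \<in> finitely_determined K"
proof (rule finitely_determinedI[of "fst ` set (from_nat n)"])
  fix k k' assume k: "k' \<in> K" "\<And>x. x \<in> fst ` set (from_nat n :: ('a \<times> 'b) list) \<Longrightarrow> k x = k' x" "k \<in> cylinder K n"
  have "k' x = j" if "(x, j) \<in> set (from_nat n)" for x j
  proof -
    have "k x = k' x" by (rule k(2)) (use that in \<open>force\<close>)
    then show ?thesis using k(3) that by (auto simp: cylinder_def)
  qed
  then show "k' \<in> cylinder K n" using k(1) by (auto simp: cylinder_def)
qed (auto simp: cylinder_def)

lemma sigma_sets_finitely_determined:
  fixes K :: "('g::countable \<Rightarrow> 'b::countable) set"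
  shows "sigma_sets K (finitely_determined K) = sigma_sets K (range (cylinder K))"
proof (rule sigma_sets_eqI)
  fix A assume "A \<in> finitely_determined K"
  then obtain F where F: "finite F" "A \<subseteq> K"
    "\<And>k k'. k \<in> K \<Longrightarrow> k' \<in> K \<Longrightarrow> (\<And>x. x \<in> F \<Longrightarrow> k x = k' x) \<Longrightarrow> k \<in> A \<Longrightarrow> k' \<in> A"
    by (rule finitely_determinedE) blast
  obtain xs where xs: "set xs = F" using finite_list[OF F(1)] by auto
  have "A = \<Union>(cylinder K ` {n. cylinder K n \<subseteq> A})"
  proof (intro equalityI subsetI)
    fix k assume k: "k \<in> A"
    let ?n = "to_nat (map (\<lambda>x. (x, k x)) xs)"
    have "k \<in> cylinder K ?n" using k F(2) by (auto simp: cylinder_def)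
    moreover have "cylinder K ?n \<subseteq> A"
    proof
      fix k' assume "k' \<in> cylinder K ?n"
      then have "k' \<in> K" "\<And>x. x \<in> F \<Longrightarrow> k x = k' x" by (auto simp: cylinder_def xs)
      then show "k' \<in> A" using F(2) k by (intro F(3)[of k k']) auto
    qed
    ultimately show "k \<in> \<Union>(cylinder K ` {n. cylinder K n \<subseteq> A})" by blast
  qed blast
  also have "\<dots> \<in> sigma_sets K (range (cylinder K))"
    by (intro sigma_sets_UNION) (auto intro: sigma_sets.Basic)
  finally show "A \<in> sigma_sets K (range (cylinder K))" .
next
  fix B assume "B \<in> range (cylinder K)"
  then show "B \<in> sigma_sets K (finitely_determined K)"
    using cylinder_finitely_determined by (auto intro: sigma_sets.Basic)
qed

lemma finitely_determined_closed:
  fixes K :: "('g \<Rightarrow> 'b::discrete_topology) set"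
  assumes "A \<in> finitely_determined K"
  obtains T where "closed T" "A = K \<inter> T"
proof -
  obtain F where F: "finite F" "A \<subseteq> K"
    "\<And>k k'. k \<in> K \<Longrightarrow> k' \<in> K \<Longrightarrow> (\<And>x. x \<in> F \<Longrightarrow> k x = k' x) \<Longrightarrow> k \<in> A \<Longrightarrow> k' \<in> A"
    using assms by (rule finitely_determinedE) blast
  let ?U = "\<Union>k\<in>K - A. \<Inter>x\<in>F. {k'. k' x \<in> {k x}}"
  have "open ((\<lambda>k'. k' x) -` {k x})" for x and k :: "'g \<Rightarrow> 'b"
    by (intro open_vimage discrete_topology_class.open_discrete continuous_on_product_coordinates)
  then have "open ?U" by (intro open_UN ballI open_INT F(1)) (simp add: vimage_def)
  moreover have "A = K \<inter> - ?U"
  proof (intro equalityI subsetI)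
    fix k assume "k \<in> A"
    then show "k \<in> K \<inter> - ?U" using F(2) F(3)[of k] by auto
  qed auto
  ultimately show thesis by (intro that[of "- ?U"] closed_Compl)
qed

lemma finitely_determined_compact:
  fixes K :: "('g \<Rightarrow> 'b::discrete_topology) set"
  assumes K: "compact K" and A: "range A \<subseteq> finitely_determined K" "decseq A" "(\<Inter>i. A i) = {}"
  shows "\<exists>i. A i = {}"
proof (rule ccontr)
  assume nonempty: "\<not> ?thesis"
  have "\<exists>T. closed T \<and> A i = K \<inter> T" for i
  proof -
    have "A i \<in> finitely_determined K" using A(1) by auto
    then show ?thesis by (rule finitely_determined_closed) blast
  qed
  then obtain T where T: "\<And>i. closed (T i)" "\<And>i. A i = K \<inter> T i" by metis
  have "K \<inter> (\<Inter>i\<in>UNIV. T i) \<noteq> {}"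
  proof (rule compact_imp_fip_image[OF K T(1)])
    fix I :: "nat set" assume I: "finite I"
    have "A (Max (insert 0 I)) \<subseteq> A i" if "i \<in> I" for i
      using A(2) I that by (auto simp: decseq_def)
    moreover have "A (Max (insert 0 I)) \<subseteq> K" using T(2) by auto
    ultimately have "A (Max (insert 0 I)) \<subseteq> K \<inter> (\<Inter>i\<in>I. T i)" using T(2) by blast
    moreover have "A (Max (insert 0 I)) \<noteq> {}" using nonempty by auto
    ultimately show "K \<inter> (\<Inter>i\<in>I. T i) \<noteq> {}" by (metis subset_empty)
  qed
  then show False using A(3) T(2) by auto
qed

lemma finitary_action_compact:
  fixes K :: "('g::{group_add, countable} \<Rightarrow> int) set"
  assumes K: "compact K" "K \<noteq> {}" "\<And>g k. k \<in> K \<Longrightarrow> fiber_act g k \<in> K"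
    and q: "prob_space q" "sets q = UNIV"
  shows "finitary_action K (finitely_determined K) (cylinder K) q fiber_act"
proof (rule finitary_action.intro)
  show "algebra K (finitely_determined K)" by (rule algebra_finitely_determined)
  show "\<exists>i. A i = {}" if "range A \<subseteq> finitely_determined K" "decseq A" "(\<Inter>i. A i) = {}" for A :: "nat \<Rightarrow> _"
    using finitely_determined_compact[OF K(1) that] .
  show "range (cylinder K) \<subseteq> finitely_determined K" using cylinder_finitely_determined by auto
  show "Int_stable (range (cylinder K))"
  proof (rule Int_stableI_image)
    fix m n
    have "cylinder K m \<inter> cylinder K n = cylinder K (to_nat (from_nat m @ from_nat n :: ('g \<times> int) list))"
      by (auto simp: cylinder_def ball_Un)
    then show "\<exists>l\<in>UNIV. cylinder K m \<inter> cylinder K n = cylinder K l" by blast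
  qed
  have "cylinder K (to_nat ([] :: ('g \<times> int) list)) = K" by (simp add: cylinder_def)
  then show "K \<in> range (cylinder K)" by (metis rangeI)
  show "sigma_sets K (finitely_determined K) = sigma_sets K (range (cylinder K))"
    by (rule sigma_sets_finitely_determined)
  show "fiber_act g -` A \<inter> K \<in> finitely_determined K" if A: "A \<in> finitely_determined K" for g A
  proof -
    obtain F where F: "finite F"
      "\<And>k k'. k \<in> K \<Longrightarrow> k' \<in> K \<Longrightarrow> (\<And>x. x \<in> F \<Longrightarrow> k x = k' x) \<Longrightarrow> k \<in> A \<Longrightarrow> k' \<in> A"
      using A by (rule finitely_determinedE) blast
    show ?thesis
    proof (rule finitely_determinedI[of "insert g ((\<lambda>x. x + g) ` F)"])
      fix k k' assume k: "k \<in> K" "k' \<in> K" "k \<in> fiber_act g -` A \<inter> K"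
        and eq: "\<And>x. x \<in> insert g ((\<lambda>x. x + g) ` F) \<Longrightarrow> k x = k' x"
      have "fiber_act g k' \<in> A"
      proof (rule F(2))
        show "fiber_act g k x = fiber_act g k' x" if "x \<in> F" for x
          using that eq[of g] eq[of "x + g"] by (simp add: fiber_act_def)
      qed (use k K(3) in auto)
      then show "k' \<in> fiber_act g -` A \<inter> K" using k by auto
    qed (use F in auto)
  qed
qed (use K q in auto)

section \<open>Measures on the hull of a twist\<close>

text \<open>Conditioning the unique invariant measure on an invariant set of positive measure gives an
  invariant measure again, so the set has full measure.\<close>

lemma uniquely_ergodic_zero_one:
  fixes \<Omega> :: "'a::{topological_space, group_add} set set"
  assumes m: "borel_prob_on \<Omega> m" "invariant_measure m" and unique: "uniquely_ergodic_on \<Omega>"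
    and meas: "\<And>g. translate g \<in> measurable m m"
    and S: "S \<in> sets m" "\<And>g Q. Q \<in> \<Omega> \<Longrightarrow> translate g Q \<in> S \<longleftrightarrow> Q \<in> S"
  shows "emeasure m S = 0 \<or> emeasure m S = 1"
proof (rule ccontr)
  assume neg: "\<not> ?thesis"
  interpret prob_space m using m(1) by (simp add: borel_prob_on_def)
  have sets_m: "sets m = sets (borel_algebra_on \<Omega>)" using m(1) by (simp add: borel_prob_on_def)
  have space_m: "space m = \<Omega>" using sets_eq_imp_space_eq[OF sets_m] by simp
  have fin: "emeasure m S \<noteq> 0" "emeasure m S \<noteq> \<infinity>" using neg by auto
  let ?u = "uniform_measure m S"
  have "borel_prob_on \<Omega> ?u"
    using prob_space_uniform_measure[OF fin] sets_m by (simp add: borel_prob_on_def)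
  moreover have "invariant_measure ?u"
    unfolding invariant_measure_def
  proof (intro allI measure_eqI)
    fix g A assume "A \<in> sets (distr ?u ?u (translate g))"
    then have A: "A \<in> sets m" by simp
    have tm: "translate g \<in> measurable ?u ?u" using meas by (simp cong: measurable_cong_sets)
    have "S \<inter> (translate g -` A \<inter> space m) = translate g -` (S \<inter> A) \<inter> space m"
      using S(2) sets.sets_into_space[OF S(1)] by (auto simp: space_m)
    then have "emeasure m (S \<inter> (translate g -` A \<inter> space m)) = emeasure (distr m m (translate g)) (S \<inter> A)"
      using meas A S(1) by (simp add: emeasure_distr)
    also have "\<dots> = emeasure m (S \<inter> A)" using m(2) by (simp add: invariant_measure_def)
    finally show "emeasure (distr ?u ?u (translate g)) A = emeasure ?u A"
      using A S(1) meas by (simp add: emeasure_distr[OF tm])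
  qed simp
  ultimately have "?u = m"
    using unique m unfolding uniquely_ergodic_on_def by blast
  moreover have "emeasure ?u S = 1"
    using fin by (rule emeasure_uniform_measure_1)
  ultimately show False using neg by simp
qed

lemma translate_prod_measurable:
  fixes \<Omega> :: "('g::{group_add, countable, discrete_topology} \<times> real) set set"
  assumes p: "sets p = sets borel"
    and \<Omega>: "\<And>C. C \<in> \<Omega> \<Longrightarrow> closed C" "\<And>g C. C \<in> \<Omega> \<Longrightarrow> translate g C \<in> \<Omega>"
  shows "(\<lambda>(g, C). translate g C) \<in> measurable (p \<Otimes>\<^sub>M borel_algebra_on \<Omega>) (borel_algebra_on \<Omega>)"
proof (rule measurable_borel_algebra_on)
  have space_p: "space p = UNIV" using sets_eq_imp_space_eq[OF p] by simp
  let ?N = "p \<Otimes>\<^sub>M borel_algebra_on \<Omega>"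
  show "(case x of (g, C) \<Rightarrow> translate g C) \<in> \<Omega>" if "x \<in> space ?N" for x
    using that \<Omega>(2) by (auto simp: space_pair_measure)
  fix \<gamma> :: 'g and r s :: real
  let ?G = "\<lambda>h (u::rat) (v::rat). {x :: 'g \<times> real. fst x \<in> {g. \<gamma> + g = h} \<and> r + snd x \<le> of_rat u \<and> of_rat v \<le> s + snd x}"
  let ?U = "\<Union>h. \<Union>u. \<Union>v. ?G h u v \<times> {C \<in> \<Omega>. C \<in> hits h (of_rat u) (of_rat v)}"
  have "{x \<in> space ?N. (case x of (g, C) \<Rightarrow> translate g C) \<in> hits \<gamma> r s} = ?U"
  proof (intro equalityI subsetI)
    fix x assume "x \<in> {x \<in> space ?N. (case x of (g, C) \<Rightarrow> translate g C) \<in> hits \<gamma> r s}"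
    then obtain g a C t where x: "x = ((g, a), C)" "C \<in> \<Omega>" and t: "r < t" "t < s" "(\<gamma> + g, t + a) \<in> C"
      by (auto simp: space_pair_measure hits_def mem_translate)
    obtain u where u: "r + a < of_rat u" "of_rat u < t + a" using of_rat_dense[of "r + a" "t + a"] t by auto
    obtain v where v: "t + a < of_rat v" "of_rat v < s + a" using of_rat_dense[of "t + a" "s + a"] t by auto
    have "(g, a) \<in> ?G (\<gamma> + g) u v" using u v by (simp add: less_imp_le)
    moreover have "C \<in> hits (\<gamma> + g) (of_rat u) (of_rat v)" using t u v unfolding hits_def by blast
    ultimately show "x \<in> ?U" using x by blast
  next
    fix x assume "x \<in> ?U"
    then obtain g a C u v t where x: "x = ((g, a), C)" "C \<in> \<Omega>"
      and t: "r + a \<le> of_rat u" "of_rat u < t" "t < of_rat v" "of_rat v \<le> s + a" "(\<gamma> + g, t) \<in> C"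
      by (auto simp: hits_def)
    then have "translate (g, a) C \<in> hits \<gamma> r s"
      by (auto simp: hits_def mem_translate intro!: exI[of _ "t - a"])
    then show "x \<in> {x \<in> space ?N. (case x of (g, C) \<Rightarrow> translate g C) \<in> hits \<gamma> r s}"
      using x by (simp add: space_pair_measure space_p)
  qed
  also have "\<dots> \<in> sets ?N"
  proof -
    have "?G h u v \<in> sets p" for h u v
    proof -
    have "closed (fst -` {g. \<gamma> + g = h} :: ('g \<times> real) set)"
      by (intro closed_vimage_fst) (simp add: closed_def discrete_topology_class.open_discrete)
    then have "closed {x :: 'g \<times> real. fst x \<in> {g. \<gamma> + g = h}}" by (simp add: vimage_def)
    then have "closed (?G h u v)"
      by (intro closed_Collect_conj closed_Collect_le continuous_intros)
    then show ?thesis unfolding p by (rule borel_closed)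
    qed
    then have "?G h u v \<times> {C \<in> \<Omega>. C \<in> hits h (of_rat u) (of_rat v)} \<in> sets ?N" for h u v
      by (intro pair_measureI hits_sets \<Omega>(1))
    then show ?thesis by (intro sets.countable_UN'' countableI_type)
  qed
  finally show "{x \<in> space ?N. (case x of (g, C) \<Rightarrow> translate g C) \<in> hits \<gamma> r s} \<in> sets ?N" .
qed (rule \<Omega>(1))

text \<open>The measure is the image of \<open>\<mu> \<times> m\<close> under \<open>F\<close>, where \<open>\<mu>\<close> is ergodic and stationary on \<open>K\<close> and \<open>m\<close> is the
  invariant measure on the hull of \<open>P\<close>. The last conclusion records that the image of \<open>F\<close> carries it.\<close>

lemma ergodic_stationary_on_twist_hull:
  fixes P :: "real set" and K :: "('g::{group_add, countable, discrete_topology} \<Rightarrow> int) set"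
    and \<phi> :: "'g \<Rightarrow> real" and p :: "('g \<times> real) measure"
  defines "\<Omega> \<equiv> orbit_closure P" and "Y \<equiv> orbit_closure (twist P \<phi>)"
  assumes unique: "uniquely_ergodic_on \<Omega>"
    and p: "prob_space p" "sets p = sets borel"
    and K: "compact K" "K \<noteq> {}" "\<And>g k. k \<in> K \<Longrightarrow> fiber_act g k \<in> K" "\<And>k. k \<in> K \<Longrightarrow> k 0 = 0"
    and K_Y: "\<And>k Q. k \<in> K \<Longrightarrow> Q \<in> \<Omega> \<Longrightarrow> twist Q (scaled c k) \<in> Y"
  obtains \<nu> where "borel_prob_on Y \<nu>" "stationary_measure p \<nu>" "ergodic_measure \<nu>"
    "\<forall>A\<in>sets \<nu>. (\<forall>k\<in>K. \<forall>Q\<in>\<Omega>. twist Q (scaled c k) \<in> A) \<longrightarrow> emeasure \<nu> A = 1"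
proof -
  let ?act = "\<lambda>(g, C). translate g C :: ('g \<times> real) set"
  define F where "F = (\<lambda>(k, Q). twist Q (scaled c k) :: ('g \<times> real) set)"
  define q where "q = distr p (count_space UNIV) fst"
  obtain m where m: "borel_prob_on \<Omega> m" "invariant_measure m"
    using unique by (auto simp: uniquely_ergodic_on_def)
  have sets_m: "sets m = sets (borel_algebra_on \<Omega>)" using m(1) by (simp add: borel_prob_on_def)
  have space_m: "space m = \<Omega>" using sets_eq_imp_space_eq[OF sets_m] by simp
  have translate_m: "translate s \<in> measurable m m" for s
    using translate_measurable[OF continuous_on_add_real, of s P] sets_m
    by (simp add: \<Omega>_def cong: measurable_cong_sets)
  have \<Omega>_inv: "translate s Q \<in> \<Omega>" if "Q \<in> \<Omega>" for s Q
    using that translate_orbit_closure[OF continuous_on_add_real] by (simp add: \<Omega>_def)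
  have Y_inv: "translate g C \<in> Y" if "C \<in> Y" for g C
    using that translate_orbit_closure[OF continuous_on_add_prod] by (simp add: Y_def)
  have Y_closed: "closed C" if "C \<in> Y" for C using that by (simp add: Y_def orbit_closure_closed)
  have \<Omega>_closed: "closed C" if "C \<in> \<Omega>" for C using that by (simp add: \<Omega>_def orbit_closure_closed)
  interpret m: prob_space m using m(1) by (simp add: borel_prob_on_def)
  interpret p: prob_space p by (rule p)

  have fst_p: "fst \<in> measurable p (count_space UNIV)"
  proof -
    have "fst -` A \<in> sets borel" for A :: "'g set"
      by (intro borel_open open_vimage_fst discrete_topology_class.open_discrete)
    then show ?thesis
      using sets_eq_imp_space_eq[OF p(2)] by (auto simp: measurable_def p(2))
  qed
  have q: "prob_space q" "sets q = UNIV" "space q = UNIV"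
    unfolding q_def using p.prob_space_distr[OF fst_p] by auto
  interpret finitary_action K "finitely_determined K" "cylinder K" q fiber_act
    by (rule finitary_action_compact[OF K(1-3) q(1,2)])
  obtain \<mu> where \<mu>: "prob_space \<mu>" "space \<mu> = K" "sets \<mu> = sigma_sets K (finitely_determined K)"
    and \<mu>_stat: "distr (q \<Otimes>\<^sub>M \<mu>) \<mu> (\<lambda>(g, k). fiber_act g k) = \<mu>"
    and \<mu>_erg: "\<And>B. B \<in> sets \<mu> \<Longrightarrow> (\<And>g. fiber_act g -` B \<inter> K = B) \<Longrightarrow> measure \<mu> B = 0 \<or> measure \<mu> B = 1"
    using ergodic_stationary_measure_exists by blast
  interpret \<mu>: prob_space \<mu> by (rule \<mu>)
  interpret N: pair_prob_space \<mu> m ..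
  let ?N = "\<mu> \<Otimes>\<^sub>M m"
  have space_N: "space ?N = K \<times> \<Omega>" by (simp add: space_pair_measure \<mu> space_m)

  have F_meas: "F \<in> measurable ?N (borel_algebra_on Y)"
  proof (rule measurable_borel_algebra_on[OF Y_closed])
    show "F x \<in> Y" if "x \<in> space ?N" for x using that K_Y by (auto simp: F_def space_N)
    fix \<gamma> :: 'g and r s :: real
    have "{x \<in> space ?N. F x \<in> hits \<gamma> r s} =
        (\<Union>j. {k \<in> K. k \<gamma> = j} \<times> ({C. closed C \<and> C \<inter> {r + c * of_int j<..<s + c * of_int j} \<noteq> {}} \<inter> \<Omega>))"
    proof (intro equalityI subsetI)
      fix x assume "x \<in> {x \<in> space ?N. F x \<in> hits \<gamma> r s}"
      then obtain k Q t where x: "x = (k, Q)" "k \<in> K" "Q \<in> \<Omega>"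
        and t: "r < t" "t < s" "c * of_int (k \<gamma>) + t \<in> Q"
        by (auto simp: F_def space_N hits_def mem_twist)
      then have "c * of_int (k \<gamma>) + t \<in> Q \<inter> {r + c * of_int (k \<gamma>)<..<s + c * of_int (k \<gamma>)}" by auto
      then have "Q \<in> {C. closed C \<and> C \<inter> {r + c * of_int (k \<gamma>)<..<s + c * of_int (k \<gamma>)} \<noteq> {}} \<inter> \<Omega>"
        using x(3) \<Omega>_closed by blast
      then show "x \<in> (\<Union>j. {k \<in> K. k \<gamma> = j} \<times>
          ({C. closed C \<and> C \<inter> {r + c * of_int j<..<s + c * of_int j} \<noteq> {}} \<inter> \<Omega>))"
        using x by blast
    next
      fix x assume "x \<in> (\<Union>j. {k \<in> K. k \<gamma> = j} \<times>
          ({C. closed C \<and> C \<inter> {r + c * of_int j<..<s + c * of_int j} \<noteq> {}} \<inter> \<Omega>))"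
      then obtain k Q where x: "x = (k, Q)" "k \<in> K" "Q \<in> \<Omega>"
        and ne: "Q \<inter> {r + c * of_int (k \<gamma>)<..<s + c * of_int (k \<gamma>)} \<noteq> {}" by blast
      from ne obtain u where "u \<in> Q" "r + c * of_int (k \<gamma>) < u" "u < s + c * of_int (k \<gamma>)"
        by auto
      then have "r < u - c * of_int (k \<gamma>)" "u - c * of_int (k \<gamma>) < s"
        "(\<gamma>, u - c * of_int (k \<gamma>)) \<in> twist Q (scaled c k)" by (auto simp: mem_twist)
      then have "F x \<in> hits \<gamma> r s" unfolding hits_def x(1) F_def by auto
      then show "x \<in> {x \<in> space ?N. F x \<in> hits \<gamma> r s}" using x by (simp add: space_N)
    qed
    also have "\<dots> \<in> sets ?N"
    proof (intro sets.countable_UN'' countableI_type pair_measureI)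
      fix j
      have "{k \<in> K. k \<gamma> = j} \<in> finitely_determined K"
        by (rule finitely_determinedI[of "{\<gamma>}"]) auto
      then show "{k \<in> K. k \<gamma> = j} \<in> sets \<mu>" by (simp add: \<mu> sigma_sets.Basic)
      show "{C. closed C \<and> C \<inter> {r + c * of_int j<..<s + c * of_int j} \<noteq> {}} \<inter> \<Omega> \<in> sets m"
        unfolding sets_m
        by (intro openin_sets_borel_algebra_on openin_chabauty_fell_hit open_greaterThanLessThan)
    qed
    finally show "{x \<in> space ?N. F x \<in> hits \<gamma> r s} \<in> sets ?N" .
  qed

  define \<nu> where "\<nu> = distr ?N (borel_algebra_on Y) F"
  have sets_\<nu>: "sets \<nu> = sets (borel_algebra_on Y)" and space_\<nu>: "space \<nu> = Y"
    by (simp_all add: \<nu>_def)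
  interpret \<nu>: prob_space \<nu> unfolding \<nu>_def by (rule N.prob_space_distr[OF F_meas])

  \<comment> \<open>the conditional probability of \<open>A\<close> given \<open>k\<close>\<close>
  define h where "h A k = emeasure m {Q \<in> \<Omega>. F (k, Q) \<in> A}" for A k
  have emeasure_\<nu>: "emeasure \<nu> A = (\<integral>\<^sup>+k. h A k \<partial>\<mu>)"
    and h_meas: "h A \<in> borel_measurable \<mu>"
    and slice_sets: "\<And>k. k \<in> K \<Longrightarrow> {Q \<in> \<Omega>. F (k, Q) \<in> A} \<in> sets m" if A: "A \<in> sets \<nu>" for A
  proof -
    let ?B = "F -` A \<inter> space ?N"
    have B: "?B \<in> sets ?N" using measurable_sets[OF F_meas] A sets_\<nu> by simp
    have slice: "Pair k -` ?B = {Q \<in> \<Omega>. F (k, Q) \<in> A}" if "k \<in> K" for k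
      using that by (auto simp: space_N)
    show "{Q \<in> \<Omega>. F (k, Q) \<in> A} \<in> sets m" if "k \<in> K" for k
      using sets_Pair1[OF B, of k] slice[OF that] by simp
    have "(\<lambda>k. emeasure m (Pair k -` ?B)) \<in> borel_measurable \<mu>"
      by (rule m.measurable_emeasure_Pair[OF B])
    then show "h A \<in> borel_measurable \<mu>"
      by (rule measurable_cong[THEN iffD1, rotated]) (simp only: h_def \<mu> slice)
    have "emeasure \<nu> A = emeasure ?N ?B"
      unfolding \<nu>_def using A sets_\<nu> by (intro emeasure_distr[OF F_meas]) simp
    also have "\<dots> = (\<integral>\<^sup>+k. emeasure m (Pair k -` ?B) \<partial>\<mu>)"
      by (rule m.emeasure_pair_measure_alt[OF B])
    also have "\<dots> = (\<integral>\<^sup>+k. h A k \<partial>\<mu>)"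
      by (intro nn_integral_cong) (simp only: slice h_def \<mu>)
    finally show "emeasure \<nu> A = (\<integral>\<^sup>+k. h A k \<partial>\<mu>)" .
  qed

  have F_translate: "translate (g, s) (F (k, Q)) = F (fiber_act g k, translate (s + c * of_int (k g)) Q)" for g s k Q
  proof -
    have "fiber_act g (scaled c k) = scaled c (fiber_act g k)"
      by (simp add: fiber_act_def right_diff_distrib)
    then show ?thesis by (simp only: F_def prod.case twist_translate)
  qed

  have act_meas: "?act \<in> measurable (p \<Otimes>\<^sub>M \<nu>) \<nu>"
  proof -
    have "?act \<in> measurable (p \<Otimes>\<^sub>M borel_algebra_on Y) (borel_algebra_on Y)"
    proof (rule translate_prod_measurable[OF p(2)])
      show "closed C" if "C \<in> Y" for C using that by (rule Y_closed)
      show "translate g C \<in> Y" if "C \<in> Y" for g C using that by (rule Y_inv)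
    qed
    moreover have "sets (p \<Otimes>\<^sub>M borel_algebra_on Y) = sets (p \<Otimes>\<^sub>M \<nu>)"
      by (rule sets_pair_measure_cong[OF refl sets_\<nu>[symmetric]])
    ultimately show ?thesis
      using measurable_cong_sets[OF _ sets_\<nu>[symmetric]] by blast
  qed

  have "stationary_measure p \<nu>"
    unfolding stationary_measure_def
  proof (rule measure_eqI)
    fix A assume "A \<in> sets (distr (p \<Otimes>\<^sub>M \<nu>) \<nu> ?act)"
    then have A: "A \<in> sets \<nu>" by simp
    let ?E = "?act -` A \<inter> space (p \<Otimes>\<^sub>M \<nu>)"
    have E: "?E \<in> sets (p \<Otimes>\<^sub>M \<nu>)" by (rule measurable_sets[OF act_meas A])
    have inner: "emeasure \<nu> (Pair x -` ?E) = (\<integral>\<^sup>+k. h A (fiber_act (fst x) k) \<partial>\<mu>)" for x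
    proof -
      obtain g s where x: "x = (g, s)" by fastforce
      have slice: "Pair x -` ?E = {C \<in> Y. translate x C \<in> A}"
        using sets_eq_imp_space_eq[OF p(2)] by (auto simp: space_pair_measure space_\<nu>)
      have h_slice: "h {C \<in> Y. translate x C \<in> A} k = h A (fiber_act g k)" if k: "k \<in> K" for k
      proof -
        let ?S = "{Q \<in> \<Omega>. F (fiber_act g k, Q) \<in> A}" and ?u = "s + c * of_int (k g)"
        have S: "?S \<in> sets m" by (rule slice_sets[OF A K(3)[OF k]])
        have "{Q \<in> \<Omega>. F (k, Q) \<in> {C \<in> Y. translate x C \<in> A}} = translate ?u -` ?S \<inter> space m"
          using k K_Y \<Omega>_inv by (auto simp: F_translate x space_m) (auto simp: F_def)
        then have "h {C \<in> Y. translate x C \<in> A} k = emeasure (distr m m (translate ?u)) ?S"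
          by (simp only: h_def emeasure_distr[OF translate_m S])
        also have "\<dots> = h A (fiber_act g k)" using m(2) by (simp add: invariant_measure_def h_def)
        finally show ?thesis .
      qed
      have "emeasure \<nu> (Pair x -` ?E) = (\<integral>\<^sup>+k. h {C \<in> Y. translate x C \<in> A} k \<partial>\<mu>)"
        using emeasure_\<nu>[OF sets_Pair1[OF E, of x]] unfolding slice .
      also have "\<dots> = (\<integral>\<^sup>+k. h A (fiber_act (fst x) k) \<partial>\<mu>)"
        by (intro nn_integral_cong) (simp only: h_slice[unfolded x] \<mu> x fst_conv)
      finally show ?thesis .
    qed
    have "emeasure (distr (p \<Otimes>\<^sub>M \<nu>) \<nu> ?act) A = emeasure (p \<Otimes>\<^sub>M \<nu>) ?E"
      by (rule emeasure_distr[OF act_meas A])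
    also have "\<dots> = (\<integral>\<^sup>+x. (\<integral>\<^sup>+k. h A (fiber_act (fst x) k) \<partial>\<mu>) \<partial>p)"
      by (simp only: \<nu>.emeasure_pair_measure_alt[OF E] inner)
    also have "\<dots> = (\<integral>\<^sup>+g. (\<integral>\<^sup>+k. h A (fiber_act g k) \<partial>\<mu>) \<partial>q)"
      unfolding q_def by (rule nn_integral_distr[OF fst_p, symmetric]) simp
    also have "\<dots> = (\<integral>\<^sup>+z. h A (case z of (g, k) \<Rightarrow> fiber_act g k) \<partial>(q \<Otimes>\<^sub>M \<mu>))"
      using \<mu>.nn_integral_fst[OF measurable_compose[OF act_measurable[OF \<mu>(2,3)] h_meas[OF A]]]
      by simp
    also have "\<dots> = (\<integral>\<^sup>+k. h A k \<partial>distr (q \<Otimes>\<^sub>M \<mu>) \<mu> (\<lambda>(g, k). fiber_act g k))"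
      by (rule nn_integral_distr[OF act_measurable[OF \<mu>(2,3)], symmetric]) (simp add: h_meas[OF A])
    also have "\<dots> = emeasure \<nu> A" by (simp add: \<mu>_stat emeasure_\<nu>[OF A])
    finally show "emeasure (distr (p \<Otimes>\<^sub>M \<nu>) \<nu> ?act) A = emeasure \<nu> A" .
  qed simp

  moreover have "ergodic_measure \<nu>"
    unfolding ergodic_measure_def
  proof (intro ballI impI)
    fix A assume A: "A \<in> sets \<nu>" and inv: "\<forall>g. translate g ` A = A"
    have A_iff: "translate g C \<in> A \<longleftrightarrow> C \<in> A" for g C
    proof
      assume "translate g C \<in> A"
      then have "translate (- g) (translate g C) \<in> translate (- g) ` A" by blast
      moreover have "translate (- g) (translate g C) = C"
        by (auto simp: translate_translate mem_translate)
      ultimately show "C \<in> A" using inv by simp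
    qed (use inv in blast)
    \<comment> \<open>the slice of an invariant set over \<open>k\<close> is invariant under the real line, which fixes \<open>k\<close>\<close>
    have h01: "h A k = 0 \<or> h A k = 1" if k: "k \<in> K" for k
      unfolding h_def
    proof (rule uniquely_ergodic_zero_one[OF m unique translate_m slice_sets[OF A k]])
      fix s Q assume Q: "Q \<in> \<Omega>"
      have "fiber_act 0 k = k" using K(4)[OF k] by (simp add: fiber_act_def)
      then have "F (k, translate s Q) = translate (0, s) (F (k, Q))"
        using F_translate[of 0 s k Q] K(4)[OF k] by simp
      then show "translate s Q \<in> {Q \<in> \<Omega>. F (k, Q) \<in> A} \<longleftrightarrow> Q \<in> {Q \<in> \<Omega>. F (k, Q) \<in> A}"
        using Q \<Omega>_inv A_iff by simp
    qed
    \<comment> \<open>the real coordinate is chosen to cancel the cocycle\<close>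
    have h_act: "h A (fiber_act g k) = h A k" for g k
    proof -
      have "F (fiber_act g k, Q) = translate (g, - c * of_int (k g)) (F (k, Q))" for Q
        using F_translate[of g "- c * of_int (k g)" k Q] by (simp add: translate_def)
      then show ?thesis by (simp add: h_def A_iff)
    qed
    let ?B = "{k \<in> K. h A k = 1}"
    have B: "?B \<in> sets \<mu>"
      using measurable_sets[OF h_meas[OF A], of "{1}"] by (simp add: vimage_def Int_def conj_commute \<mu>)
    have "fiber_act g -` ?B \<inter> K = ?B" for g using K(3) by (auto simp: h_act)
    then have "measure \<mu> ?B = 0 \<or> measure \<mu> ?B = 1" using \<mu>_erg[OF B] by blast
    moreover have "emeasure \<nu> A = emeasure \<mu> ?B"
    proof -
      have "emeasure \<nu> A = (\<integral>\<^sup>+k. indicator ?B k \<partial>\<mu>)"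
        unfolding emeasure_\<nu>[OF A]
        by (intro nn_integral_cong) (use h01 in \<open>auto simp: \<mu> indicator_def\<close>)
      then show ?thesis using B by simp
    qed
    ultimately show "emeasure \<nu> A = 0 \<or> emeasure \<nu> A = 1" by (auto simp: \<mu>.emeasure_eq_measure)
  qed
  moreover have "borel_prob_on Y \<nu>"
    unfolding borel_prob_on_def using \<nu>.prob_space_axioms sets_\<nu> by simp
  moreover have "\<forall>A\<in>sets \<nu>. (\<forall>k\<in>K. \<forall>Q\<in>\<Omega>. twist Q (scaled c k) \<in> A) \<longrightarrow> emeasure \<nu> A = 1"
  proof (intro ballI impI)
    fix A assume A: "A \<in> sets \<nu>" and all: "\<forall>k\<in>K. \<forall>Q\<in>\<Omega>. twist Q (scaled c k) \<in> A"
    have "h A k = 1" if "k \<in> K" for k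
    proof -
      have "{Q \<in> \<Omega>. F (k, Q) \<in> A} = space m" using all that by (auto simp: F_def space_m)
      then show ?thesis by (simp add: h_def m.emeasure_space_1)
    qed
    then have "emeasure \<nu> A = (\<integral>\<^sup>+k. 1 \<partial>\<mu>)"
      unfolding emeasure_\<nu>[OF A] by (intro nn_integral_cong) (simp add: \<mu>)
    then show "emeasure \<nu> A = 1" by (simp add: \<mu>.emeasure_space_1)
  qed
  ultimately show thesis by (intro that)
qed

section \<open>Telling the measures apart\<close>

text \<open>The sets whose fibre over \<open>\<gamma>\<close> is a translate, by an element of \<open>c\<int>\<close>, of the fibre over \<open>0\<close>.\<close>

definition fiber_translate :: "real \<Rightarrow> 'g::zero \<Rightarrow> ('g \<times> real) set set" where
  "fiber_translate c \<gamma> = {C. \<exists>j::int. \<forall>t. (\<gamma>, t) \<in> C \<longleftrightarrow> (0, t + c * of_int j) \<in> C}"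

lemma closed_real_eq_iff_rational_hits:
  fixes A B :: "real set"
  assumes "closed A" "closed B"
  shows "A = B \<longleftrightarrow> (\<forall>r s::rat. A \<inter> {of_rat r<..<of_rat s} \<noteq> {} \<longleftrightarrow> B \<inter> {of_rat r<..<of_rat s} \<noteq> {})"
    (is "_ \<longleftrightarrow> ?R")
proof
  have sub: "A \<subseteq> B"
    if "closed B" and *: "\<And>r s::rat. A \<inter> {of_rat r<..<of_rat s} \<noteq> {} \<Longrightarrow> B \<inter> {of_rat r<..<of_rat s} \<noteq> {}"
    for A B :: "real set"
  proof (rule ccontr)
    assume "\<not> A \<subseteq> B"
    then obtain t where t: "t \<in> A" "t \<in> - B" by blast
    then obtain e where e: "0 < e" "ball t e \<subseteq> - B"
      using \<open>closed B\<close> unfolding closed_def open_contains_ball by blast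
    obtain r where r: "t - e < of_rat r" "of_rat r < t" using of_rat_dense[of "t - e" t] e(1) by auto
    obtain s where s: "t < of_rat s" "of_rat s < t + e" using of_rat_dense[of t "t + e"] e(1) by auto
    have "B \<inter> {of_rat r<..<of_rat s} \<noteq> {}" using t(1) r s by (intro *) auto
    moreover have "{of_rat r<..<of_rat s} \<subseteq> ball t e" using r s by (auto simp: dist_real_def)
    ultimately show False using e(2) by blast
  qed
  assume ?R
  then show "A = B" using sub[OF assms(2), of A] sub[OF assms(1), of B] by blast
qed simp

lemma fiber_translate_sets:
  fixes \<Omega> :: "('g::{zero, countable, discrete_topology} \<times> real) set set"
  assumes \<Omega>: "\<And>C. C \<in> \<Omega> \<Longrightarrow> closed C"
  shows "\<Omega> \<inter> fiber_translate c \<gamma> \<in> sets (borel_algebra_on \<Omega>)"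
proof -
  let ?M = "borel_algebra_on \<Omega>"
  let ?hit = "\<lambda>j r s C. C \<in> hits \<gamma> (of_rat r) (of_rat s) \<longleftrightarrow>
      C \<in> hits 0 (of_rat r + c * of_int j) (of_rat s + c * of_int j)"
  have "(\<forall>t. (\<gamma>, t) \<in> C \<longleftrightarrow> (0, t + c * of_int j) \<in> C) \<longleftrightarrow> (\<forall>r s. ?hit j r s C)"
    if "C \<in> \<Omega>" for C and j :: int
  proof -
    let ?A = "{t. (\<gamma>, t) \<in> C}" and ?B = "{t. (0, t + c * of_int j) \<in> C}"
    have "closed ((\<lambda>t. (\<gamma>, t)) -` C)" "closed ((\<lambda>t. (0, t + c * of_int j)) -` C)"
      by (intro closed_vimage \<Omega>[OF that] continuous_intros)+
    then have AB: "closed ?A" "closed ?B" by (simp_all add: vimage_def)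
    have "?A \<inter> {of_rat r<..<of_rat s} \<noteq> {} \<longleftrightarrow> C \<in> hits \<gamma> (of_rat r) (of_rat s)" for r s
      by (auto simp: hits_def)
    moreover have "?B \<inter> {of_rat r<..<of_rat s} \<noteq> {} \<longleftrightarrow>
        C \<in> hits 0 (of_rat r + c * of_int j) (of_rat s + c * of_int j)" for r s
    proof
      assume "C \<in> hits 0 (of_rat r + c * of_int j) (of_rat s + c * of_int j)"
      then obtain t where "of_rat r + c * of_int j < t" "t < of_rat s + c * of_int j" "(0, t) \<in> C"
        by (auto simp: hits_def)
      then have "t - c * of_int j \<in> ?B \<inter> {of_rat r<..<of_rat s}" by simp
      then show "?B \<inter> {of_rat r<..<of_rat s} \<noteq> {}" by blast
    qed (auto simp: hits_def intro: add_strict_right_mono)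
    ultimately have "?A = ?B \<longleftrightarrow> (\<forall>r s. ?hit j r s C)"
      by (simp only: closed_real_eq_iff_rational_hits[OF AB])
    then show ?thesis by (simp add: set_eq_iff)
  qed
  then have "\<Omega> \<inter> fiber_translate c \<gamma> = {C \<in> space ?M. \<exists>j. \<forall>r s. ?hit j r s C}"
    by (auto simp: fiber_translate_def)
  also have "\<dots> \<in> sets ?M"
  proof -
    have "{C \<in> space ?M. C \<in> hits x u v} \<in> sets ?M" for x u v
      using hits_sets[OF \<Omega>] by simp
    then have "{C \<in> space ?M. ?hit j r s C} \<in> sets ?M" for j r s
      unfolding iff_conv_conj_imp
      by (intro sets.sets_Collect_conj sets.sets_Collect_imp)
    then show ?thesis
      by (intro sets.sets_Collect_countable_Ex sets.sets_Collect_countable_All)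
  qed
  finally show ?thesis .
qed

lemma countable_commensurable: "countable {x::real. \<exists>i j::int. j \<noteq> 0 \<and> x * of_int j = y * of_int i}"
proof (rule countable_subset)
  show "{x. \<exists>i j::int. j \<noteq> 0 \<and> x * of_int j = y * of_int i}
      \<subseteq> range (\<lambda>(i, j). y * of_int (i::int) / of_int (j::int))"
  proof clarify
    fix x and i j :: int assume "j \<noteq> 0" "x * of_int j = y * of_int i"
    then have "x = y * of_int i / of_int j" by (simp add: field_simps)
    then show "x \<in> range (\<lambda>(i, j). y * of_int (i::int) / of_int (j::int))"
      by (intro image_eqI[of _ _ "(i, j)"]) auto
  qed
qed (rule countable_image, rule countableI_type)

lemma uncountable_range_countable_fibers:
  fixes f :: "'a \<Rightarrow> 'b"
  assumes "uncountable S" "\<And>x. x \<in> S \<Longrightarrow> countable {y \<in> S. f y = f x}"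
  shows "uncountable (f ` S)"
proof
  assume "countable (f ` S)"
  then have "countable (\<Union>z\<in>f ` S. {y \<in> S. f y = z})"
    using assms(2) by (intro countable_UN) auto
  moreover have "(\<Union>z\<in>f ` S. {y \<in> S. f y = z}) = S" by auto
  ultimately show False using assms(1) by simp
qed

theorem theorem1p6:
  fixes P :: "real set"
    and \<phi> :: "'g::{group_add, countable, discrete_topology} \<Rightarrow> real"
    and p :: "('g \<times> real) measure"
  assumes "closed P"
    and "free_action_on (orbit_closure P)"
    and "uniquely_ergodic_on (orbit_closure P)"
    and "quasimorphism \<phi>"
    and "\<not> (\<exists>\<psi>. real_homomorphism \<psi> \<and> bounded_distance \<phi> \<psi>)"
    and "prob_space p" and "sets p = sets borel"
    and "symmetric_measure p"
    and "absolutely_continuous haar_prod p"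
    and "semigroup_generated (measure_support p) = UNIV"
    and "p_integrable p \<phi>"
  shows "\<exists>\<phi>'. quasimorphism \<phi>' \<and> bounded_distance \<phi>' \<phi> \<and>
    uncountable {\<nu>. borel_prob_on (orbit_closure (twist P \<phi>')) \<nu> \<and>
      stationary_measure p \<nu> \<and> ergodic_measure \<nu>}"
proof -
  obtain c :: "nat \<Rightarrow> real" where c: "\<And>m. 1 \<le> c m \<and> c m \<le> 2"
    "\<And>x e N. x \<in> {1..2} \<Longrightarrow> 0 < e \<Longrightarrow> \<exists>m\<ge>N. \<bar>c m - x\<bar> < e"
    using recurrent_dense_sequence by blast
  define \<phi>' where "\<phi>' = round_to c \<circ> \<phi>"
  let ?\<Omega> = "orbit_closure P" and ?Y = "orbit_closure (twist P \<phi>')"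
  let ?K = "\<lambda>x. integral_limits x \<phi>'"
  obtain D where D: "0 \<le> D" "\<And>g h. \<bar>\<phi> (g + h) - \<phi> g - \<phi> h\<bar> \<le> D"
    using quasimorphism_defect[OF assms(4)] by blast
  have close: "\<bar>\<phi>' g - \<phi> g\<bar> \<le> 2" for g
    using round_to_close[OF c(1)] by (simp add: \<phi>'_def)
  have D': "\<bar>\<phi>' (g + h) - \<phi>' g - \<phi>' h\<bar> \<le> D + 6" for g h
    using D(2)[of g h] close[of "g + h"] close[of g] close[of h] by linarith
  have "quasimorphism \<phi>'"
    using assms(4) D' by (intro quasimorphismI) (simp_all add: \<phi>'_def round_to_def quasimorphism_def)
  moreover have "bounded_distance \<phi>' \<phi>"
    unfolding bounded_distance_def bounded_iff using close by (auto intro!: exI[of _ 2])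
  moreover have "uncountable {\<nu>. borel_prob_on ?Y \<nu> \<and> stationary_measure p \<nu> \<and> ergodic_measure \<nu>}"
  proof -
    \<comment> \<open>limits stay within \<open>D + 6\<close> of \<open>\<phi>'\<close> and hence within \<open>D + 8\<close> of \<open>\<phi>\<close>, so they do not vanish at \<open>\<gamma>\<close>\<close>
    obtain \<gamma> where \<gamma>: "\<phi> \<gamma> > D + 8"
      using quasimorphism_unbounded_above[OF assms(4,5)] by blast
    have "\<exists>\<nu>. borel_prob_on ?Y \<nu> \<and> stationary_measure p \<nu> \<and> ergodic_measure \<nu> \<and>
        (\<forall>A\<in>sets \<nu>. (\<forall>k\<in>?K x. \<forall>Q\<in>?\<Omega>. twist Q (scaled x k) \<in> A) \<longrightarrow> emeasure \<nu> A = 1)"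
      if x: "x \<in> {1..2}" for x
    proof -
      have x1: "1 \<le> x" using x by simp
      show ?thesis
      proof (rule ergodic_stationary_on_twist_hull[OF assms(3,6,7),
            where K = "?K x" and \<phi> = \<phi>' and c = x])
        show "compact (?K x)" by (rule compact_integral_limits[OF x1 D'])
        show "?K x \<noteq> {}"
          unfolding \<phi>'_def
          by (rule integral_limits_nonempty[OF assms(4,5) c x D'[unfolded \<phi>'_def o_def]])
        show "fiber_act g k \<in> ?K x" if "k \<in> ?K x" for g k
          using that by (rule integral_limits_act)
        show "k 0 = 0" if "k \<in> ?K x" for k
          using integral_limits_0[OF that] x1 by simp
        show "twist Q (scaled x k) \<in> ?Y" if "k \<in> ?K x" "Q \<in> ?\<Omega>" for k Q
          using that by (intro twist_in_orbit_closure) (auto simp: integral_limits_def)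
        show ?thesis
          if "borel_prob_on ?Y \<nu>" "stationary_measure p \<nu>" "ergodic_measure \<nu>"
            "\<forall>A\<in>sets \<nu>. (\<forall>k\<in>?K x. \<forall>Q\<in>?\<Omega>. twist Q (scaled x k) \<in> A) \<longrightarrow> emeasure \<nu> A = 1" for \<nu>
          using that by blast
      qed
    qed
    then obtain \<nu> where \<nu>: "\<And>x. x \<in> {1..2} \<Longrightarrow> borel_prob_on ?Y (\<nu> x)"
      "\<And>x. x \<in> {1..2} \<Longrightarrow> stationary_measure p (\<nu> x)" "\<And>x. x \<in> {1..2} \<Longrightarrow> ergodic_measure (\<nu> x)"
      and full: "\<And>x A. x \<in> {1..2} \<Longrightarrow> A \<in> sets (\<nu> x) \<Longrightarrow>
        (\<forall>k\<in>?K x. \<forall>Q\<in>?\<Omega>. twist Q (scaled x k) \<in> A) \<Longrightarrow> emeasure (\<nu> x) A = 1"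
      by metis
    have "\<exists>i j::int. j \<noteq> 0 \<and> y * of_int j = x * of_int i"
      if xy: "x \<in> {1..2}" "y \<in> {1..2}" and eq: "\<nu> y = \<nu> x" for x y
    proof (rule ccontr)
      assume incomm: "\<not> ?thesis"
      have sets_\<nu>: "sets (\<nu> x) = sets (borel_algebra_on ?Y)" and prob: "prob_space (\<nu> x)"
        using \<nu>(1)[OF xy(1)] by (simp_all add: borel_prob_on_def)
      interpret prob_space "\<nu> x" by (rule prob)
      let ?E = "?Y \<inter> fiber_translate x \<gamma>"
      have E: "?E \<in> sets (\<nu> x)"
        unfolding sets_\<nu> by (rule fiber_translate_sets[OF orbit_closure_closed])
      have "emeasure (\<nu> x) ?E = 1"
      proof (rule full[OF xy(1) E], intro ballI)
        fix k Q assume k: "k \<in> ?K x" and Q: "Q \<in> ?\<Omega>"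
        have "twist Q (scaled x k) \<in> ?Y"
          using k Q by (intro twist_in_orbit_closure) (auto simp: integral_limits_def)
        moreover have "k 0 = 0" using integral_limits_0[OF k] xy(1) by simp
        then have "twist Q (scaled x k) \<in> fiber_translate x \<gamma>"
          by (auto simp: fiber_translate_def mem_twist add.commute intro!: exI[of _ "k \<gamma>"])
        ultimately show "twist Q (scaled x k) \<in> ?E" by blast
      qed
      moreover have "emeasure (\<nu> y) (space (\<nu> x) - ?E) = 1"
      proof (rule full[OF xy(2)], unfold eq, intro sets.compl_sets E, intro ballI)
        fix k Q assume k: "k \<in> ?K y" and Q: "Q \<in> ?\<Omega>"
        have "twist Q (scaled y k) \<in> ?Y"
          using k Q by (intro twist_in_orbit_closure) (auto simp: integral_limits_def)
        moreover have "twist Q (scaled y k) \<notin> fiber_translate x \<gamma>"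
        proof
          assume "twist Q (scaled y k) \<in> fiber_translate x \<gamma>"
          then obtain j :: int
            where j: "\<And>t. (\<gamma>, t) \<in> twist Q (scaled y k) \<longleftrightarrow> (0, t + x * of_int j) \<in> twist Q (scaled y k)"
            by (auto simp: fiber_translate_def)
          have "k 0 = 0" using integral_limits_0[OF k] xy(2) by simp
          then have *: "y * of_int (k \<gamma>) + t \<in> Q \<longleftrightarrow> t + x * of_int j \<in> Q" for t
            using j[of t] by (simp add: mem_twist)
          have "t + (y * of_int (k \<gamma>) - x * of_int j) \<in> Q \<longleftrightarrow> t \<in> Q" for t
            using *[of "t - x * of_int j"] by (simp add: algebra_simps)
          then have "translate (y * of_int (k \<gamma>) - x * of_int j) Q = Q"
            by (intro set_eqI) (simp only: mem_translate)
          then have "y * of_int (k \<gamma>) - x * of_int j = 0"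
            using assms(2) Q unfolding free_action_on_def by blast
          moreover have "k \<gamma> \<noteq> 0"
            using integral_limits_close[OF k D', of \<gamma>] close[of \<gamma>] \<gamma> by auto
          ultimately show False using incomm by auto
        qed
        ultimately show "twist Q (scaled y k) \<in> space (\<nu> x) - ?E"
          using sets_eq_imp_space_eq[OF sets_\<nu>] by simp
      qed
      ultimately show False
        using prob_compl[OF E] by (simp add: eq emeasure_eq_measure)
    qed
    then have "countable {y \<in> {1..2}. \<nu> y = \<nu> x}" if "x \<in> {1..2}" for x
      using that by (intro countable_subset[OF _ countable_commensurable[of x]]) auto
    then have "uncountable (\<nu> ` {1..2})"
      by (intro uncountable_range_countable_fibers) (simp_all add: uncountable_closed_interval)
    moreover have "\<nu> ` {1..2} \<subseteq> {\<nu>. borel_prob_on ?Y \<nu> \<and> stationary_measure p \<nu> \<and> ergodic_measure \<nu>}"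
      using \<nu> by auto
    ultimately show ?thesis using countable_subset by blast
  qed
  ultimately show ?thesis by blast
qed

end
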